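(* For every integer $n\ge 0$, let $q_n,r_n$ be the polynomials defined in the context. Then each of $q_n,r_n$ is monic whenever it is nonzero, and, with the convention that the zero polynomial has degree $-1$, $$\deg(q_n)+1=\deg(r_n)=\tfrac{n^2}{12}\ \ (n\equiv 0 \bmod 6),\qquad \deg(q_n)=\deg(r_n)+1=\tfrac{n^2-1}{12}\ \ (n\equiv \pm1 \bmod 6),$$ $$\deg(q_n)=\deg(r_n)=\tfrac{n^2-4}{12}\ \ (n\equiv \pm 2 \bmod 6),\qquad \deg(q_n)=\deg(r_n)=\tfrac{n^2-9}{12}\ \ (n\equiv 3 \bmod 6).$$
   Context: Fix an integer $n\geq 0$. A three-coloured chessboard of size $n$ is a labelling of the squares of an $(n+1)\times(n+1)$ board (rows numbered top to bottom, columns left to right) by colours in $\mathbb Z/3\mathbb Z$ such that horizontally or vertically adjacent squares have distinct colours, and such that for $1\le i\le n+1$ the squares (row $1$, column $i$), (row $i$, column $1$), (row $n+1$, column $n+2-i$), (row $n+2-i$, column $n+1$) have colour $i-1\bmod 3$. Let $Z_n^{3C}(t_0,t_1,t_2)=\sum_{\text{chessboards}}\prod_{\text{squares}}t_{\text{colour}}$. Write $e_2=t_0t_1+t_0t_2+t_1t_2$, $e_3=t_0t_1t_2$, $T=e_2^3/e_3^2$, $\chi(\text{true})=1$, $\chi(\text{false})=0$. The polynomials $q_n,r_n$ (in one variable) are the unique polynomials such that: for $n\equiv0\pmod 3$, $Z_n^{3C}=(-1)^{n+1}e_3^{n(n+2)/3}\big(\frac{e_2^2}{e_3}q_n(T)-2^{\chi(n\text{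 odd})}t_0r_n(T)\big)$; for $n\equiv1\pmod3$, $Z_n^{3C}=(-1)^{n+1}e_3^{n(n+2)/3}\big(\frac{t_0t_1}{t_2}q_n(T)-2^{\chi(n\text{ odd})}\frac{e_2}{t_2}r_n(T)\big)$; for $n\equiv 2\pmod 3$, $Z_n^{3C}=(-1)^{n+1}e_3^{(n+1)^2/3}\big(q_n(T)-2^{\chi(n\text{ odd})}\frac{e_2}{t_0t_2}r_n(T)\big)$. *)

theory Defs
  imports Complex_Main "HOL-Library.FuncSet" "HOL-Computational_Algebra.Polynomial"
begin

text \<open>Colours in \<open>\<int>/3\<int>\<close> are represented by the residues \<open>0, 1, 2 :: nat\<close>; a square is a pair
  (row, column), both counted from 1.\<close>

definition squares :: "nat \<Rightarrow> (nat \<times> nat) set" where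
  "squares n = {1..n+1} \<times> {1..n+1}"

definition chessboards :: "nat \<Rightarrow> (nat \<times> nat \<Rightarrow> nat) set" where
  "chessboards n = {c \<in> squares n \<rightarrow>\<^sub>E {0, 1, 2}.
     (\<forall>i\<in>{1..n+1}. \<forall>j\<in>{1..n}. c (i, j) \<noteq> c (i, j+1)) \<and>
     (\<forall>i\<in>{1..n}. \<forall>j\<in>{1..n+1}. c (i, j) \<noteq> c (i+1, j)) \<and>
     (\<forall>i\<in>{1..n+1}.
        c (1, i) = (i - 1) mod 3 \<and>
        c (i, 1) = (i - 1) mod 3 \<and>
        c (n+1, n+2-i) = (i - 1) mod 3 \<and>
        c (n+2-i, n+1) = (i - 1) mod 3)}"

text \<open>The variables \<open>t\<^sub>0, t\<^sub>1, t\<^sub>2\<close> are \<open>t 0, t 1, t 2\<close>; other values of \<open>t\<close> are irrelevant.\<close>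

definition Z3C :: "nat \<Rightarrow> (nat \<Rightarrow> complex) \<Rightarrow> complex" where
  "Z3C n t = (\<Sum>c\<in>chessboards n. \<Prod>s\<in>squares n. t (c s))"

definition e2 :: "(nat \<Rightarrow> complex) \<Rightarrow> complex" where
  "e2 t = t 0 * t 1 + t 0 * t 2 + t 1 * t 2"

definition e3 :: "(nat \<Rightarrow> complex) \<Rightarrow> complex" where
  "e3 t = t 0 * t 1 * t 2"

definition TT :: "(nat \<Rightarrow> complex) \<Rightarrow> complex" where
  "TT t = e2 t ^ 3 / e3 t ^ 2"

text \<open>The identity defining \<open>(q\<^sub>n, r\<^sub>n)\<close>. An identity of rational functions in \<open>t\<^sub>0, t\<^sub>1, t\<^sub>2\<close> is stated
  as equality at all points where the denominators do not vanish. The divisions by 3 in the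
  exponents are exact.\<close>

definition is_qr :: "nat \<Rightarrow> complex poly \<Rightarrow> complex poly \<Rightarrow> bool" where
  "is_qr n q r \<longleftrightarrow> (\<forall>t. t 0 \<noteq> 0 \<and> t 1 \<noteq> 0 \<and> t 2 \<noteq> 0 \<longrightarrow>
     (n mod 3 = 0 \<longrightarrow> Z3C n t = (-1) ^ (n+1) * e3 t ^ (n * (n+2) div 3) *
        (e2 t ^ 2 / e3 t * poly q (TT t) - 2 ^ of_bool (odd n) * t 0 * poly r (TT t))) \<and>
     (n mod 3 = 1 \<longrightarrow> Z3C n t = (-1) ^ (n+1) * e3 t ^ (n * (n+2) div 3) *
        (t 0 * t 1 / t 2 * poly q (TT t) - 2 ^ of_bool (odd n) * (e2 t / t 2) * poly r (TT t))) \<and>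
     (n mod 3 = 2 \<longrightarrow> Z3C n t = (-1) ^ (n+1) * e3 t ^ ((n+1) ^ 2 div 3) *
        (poly q (TT t) - 2 ^ of_bool (odd n) * (e2 t / (t 0 * t 2)) * poly r (TT t))))"

definition deg :: "complex poly \<Rightarrow> int" where
  "deg p = (if p = 0 then -1 else int (degree p))"

end

theory Submission
  imports Defs
begin

text \<open>Set one variable to \<open>x\<close> and the other two to 1. Then \<open>TT = (1 + 2 * x) ^ 3 / x ^ 2\<close> tends to
  infinity as \<open>x\<close> tends to 0, so the leading coefficients of \<open>q\<close> and \<open>r\<close> can be read off from the lowest
  order terms of the partition function, that is, from the chessboards with the fewest squares of
  the chosen colour.

  Lifting a chessboard to a height function, every row has to cross the heights of the chosen class
  modulo 3 lying between its end points, and the number of squares of the colour exceeds the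
  resulting minimum exactly by the number of row steps crossing in the wrong direction. For the
  colour of the largest height \<open>g < n / 2\<close> the minimum is attained by one board only. For even \<open>n\<close> this
  determines the top coefficient of \<open>r\<close>; for the colour of \<open>n / 2\<close> the minimum is not attained, which
  forces the top terms of \<open>q\<close> and \<open>r\<close> to cancel. For odd \<open>n\<close> the minimum determines the top
  coefficient of \<open>q\<close>, and that of \<open>r\<close> appears in the next order in \<open>x\<close>: the boards with one more
  square of the colour arise from the minimal one by changing a single square, and there are
  \<open>(n\<^sup>2 - 5) / 2\<close> of them if \<open>n > 1\<close>.\<close>

subsection \<open>Height functions\<close>

text \<open>Bad steps are defined by rows only, yet they control columns as well: the number of
  squares of a class is unchanged by transposition and by the half-turn, and the row minima do not
  depend on the height function, so the number of bad steps is invariant too. This is what makes the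
  minimal board rigid.

  No bound on the degrees of \<open>q\<close> and \<open>r\<close> is known beforehand. It is
  produced by a descent that works because \<open>TT\<close> is \<open>x ^ (-2)\<close> times a
  power series: for a suitable colour the terms of \<open>q\<close> and \<open>r\<close> start in
  orders of \<open>x\<close> of different parity, so their tops cannot cancel. For even
  \<open>n\<close> the second order is not counted; a second colour takes its place.

  For odd \<open>n > 1\<close> the number of flippable squares falls short by exactly 2 of what the
  expansion of the top term of \<open>q\<close> predicts. This is the factor \<open>2\<close> put
  before \<open>r\<close> in the definition, hence \<open>r\<close> is monic.\<close>

text \<open>Heights are indexed from 0: \<open>H i j\<close> belongs to the square \<open>(i + 1, j + 1)\<close>, whose colour is
  \<open>H i j mod 3\<close>.\<close>

definition height_fun :: "nat \<Rightarrow> (nat \<Rightarrow> nat \<Rightarrow> int) \<Rightarrow> bool" where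
  "height_fun n H \<longleftrightarrow>
     (\<forall>i\<le>n. \<forall>j<n. \<bar>H i (Suc j) - H i j\<bar> = 1) \<and>
     (\<forall>i<n. \<forall>j\<le>n. \<bar>H (Suc i) j - H i j\<bar> = 1) \<and>
     (\<forall>k\<le>n. H 0 k = int k \<and> H k 0 = int k \<and> H n k = int n - int k \<and> H k n = int n - int k)"

lemma height_funD:
  assumes "height_fun n H"
  shows "i \<le> n \<Longrightarrow> j < n \<Longrightarrow> H i (Suc j) = H i j + 1 \<or> H i (Suc j) = H i j - 1"
    "i < n \<Longrightarrow> j \<le> n \<Longrightarrow> H (Suc i) j = H i j + 1 \<or> H (Suc i) j = H i j - 1"
    "k \<le> n \<Longrightarrow> H 0 k = int k" "k \<le> n \<Longrightarrow> H k 0 = int k"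
    "k \<le> n \<Longrightarrow> H n k = int n - int k" "k \<le> n \<Longrightarrow> H k n = int n - int k"
proof -
  have "H i (Suc j) = H i j + 1 \<or> H i (Suc j) = H i j - 1" if "\<bar>H i (Suc j) - H i j\<bar> = 1"
    using that by linarith
  then show "i \<le> n \<Longrightarrow> j < n \<Longrightarrow> H i (Suc j) = H i j + 1 \<or> H i (Suc j) = H i j - 1"
    using assms unfolding height_fun_def by blast
  have "H (Suc i) j = H i j + 1 \<or> H (Suc i) j = H i j - 1" if "\<bar>H (Suc i) j - H i j\<bar> = 1"
    using that by linarith
  then show "i < n \<Longrightarrow> j \<le> n \<Longrightarrow> H (Suc i) j = H i j + 1 \<or> H (Suc i) j = H i j - 1"
    using assms unfolding height_fun_def by blast
qed (use assms in \<open>simp_all add: height_fun_def\<close>)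

section \<open>Symmetries and elementary bounds\<close>

lemma height_fun_transpose: "height_fun n H \<Longrightarrow> height_fun n (\<lambda>i j. H j i)"
  by (simp add: height_fun_def)

lemma height_fun_rotate:
  assumes "height_fun n H"
  shows "height_fun n (\<lambda>i j. H (n - i) (n - j))"
proof -
  have "\<bar>H (n - i) (n - Suc j) - H (n - i) (n - j)\<bar> = 1" if "i \<le> n" "j < n" for i j
    using height_funD(1)[OF assms, of "n - i" "n - Suc j"] that by (auto simp: Suc_diff_Suc)
  moreover have "\<bar>H (n - Suc i) (n - j) - H (n - i) (n - j)\<bar> = 1" if "i < n" "j \<le> n" for i j
    using height_funD(2)[OF assms, of "n - Suc i" "n - j"] that by (auto simp: Suc_diff_Suc)
  ultimately show ?thesis
    using height_funD(3-6)[OF assms] by (auto simp: height_fun_def of_nat_diff)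
qed

text \<open>Reversing the columns interchanges the two ends of each row; complementing the heights
  restores the boundary values. It carries facts about the top left corner to the top right
  one.\<close>

lemma height_fun_reflect:
  assumes "height_fun n H"
  shows "height_fun n (\<lambda>i j. int n - H i (n - j))"
proof -
  have "\<bar>H i (n - Suc j) - H i (n - j)\<bar> = 1" if "i \<le> n" "j < n" for i j
    using height_funD(1)[OF assms, of i "n - Suc j"] that by (auto simp: Suc_diff_Suc)
  moreover have "\<bar>H (Suc i) (n - j) - H i (n - j)\<bar> = 1" if "i < n" "j \<le> n" for i j
    using height_funD(2)[OF assms, of i "n - j"] that by (auto simp: Suc_diff_Suc)
  ultimately show ?thesis
    using height_funD(3-6)[OF assms]
    by (simp add: height_fun_def of_nat_diff abs_minus_commute)
qed

lemma height_parity: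
  assumes "height_fun n H" "i \<le> n" "j \<le> n"
  shows "even (H i j - int i - int j)"
  using assms(3)
proof (induction j)
  case 0
  then show ?case using height_funD(4)[OF assms(1)] assms(2) by simp
next
  case (Suc j)
  then show ?case using height_funD(1)[OF assms(1,2), of j] by auto
qed

lemma height_lipschitz:
  assumes "height_fun n H" "i \<le> n" "j + k \<le> n"
  shows "\<bar>H i (j + k) - H i j\<bar> \<le> int k"
  using assms(3)
proof (induction k)
  case (Suc k)
  then show ?case using height_funD(1)[OF assms(1,2), of "j + k"] by auto
qed simp

text \<open>The level changes by one exactly on the steps that enter or leave a height of the class
  \<open>\<gamma> + 3\<int>\<close>, so twice the number of visits of a walk to the class is, up to the end points, the total
  variation of the level along the walk.\<close>

definition level :: "int \<Rightarrow> int \<Rightarrow> int" where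
  "level \<gamma> h = 2 * ((h - \<gamma>) div 3) + of_bool ((h - \<gamma>) mod 3 \<noteq> 0)"

definition in_class :: "int \<Rightarrow> int \<Rightarrow> bool" where
  "in_class \<gamma> h \<longleftrightarrow> (h - \<gamma>) mod 3 = 0"

lemma level_add_1: "level \<gamma> (h + 1) = level \<gamma> h + of_bool (in_class \<gamma> h) + of_bool (in_class \<gamma> (h + 1))"
proof -
  define k where "k = h - \<gamma>"
  have k: "h - \<gamma> = k" "h + 1 - \<gamma> = k + 1" by (simp_all add: k_def)
  consider "k mod 3 = 0" | "k mod 3 = 1" | "k mod 3 = 2" by linarith
  then show ?thesis
  proof cases
    case 1
    then have "(k + 1) mod 3 = 1" "(k + 1) div 3 = k div 3" by presburger+
    with 1 show ?thesis by (simp add: level_def in_class_def k)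
  next
    case 2
    then have "(k + 1) mod 3 = 2" "(k + 1) div 3 = k div 3" by presburger+
    with 2 show ?thesis by (simp add: level_def in_class_def k)
  next
    case 3
    then have "(k + 1) mod 3 = 0" "(k + 1) div 3 = k div 3 + 1" by presburger+
    with 3 show ?thesis by (simp add: level_def in_class_def k)
  qed
qed

lemma level_diff_1: "level \<gamma> (h - 1) = level \<gamma> h - of_bool (in_class \<gamma> h) - of_bool (in_class \<gamma> (h - 1))"
  using level_add_1[of \<gamma> "h - 1"] by simp

lemma in_class_adjacent: "in_class \<gamma> h \<Longrightarrow> \<not> in_class \<gamma> (h + 1)" "in_class \<gamma> h \<Longrightarrow> \<not> in_class \<gamma> (h - 1)"
  unfolding in_class_def by presburger+

lemma level_mono: "h \<le> h' \<Longrightarrow> level \<gamma> h \<le> level \<gamma> h'"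
  by (induction h' rule: int_ge_induct) (auto simp: level_add_1)

lemma level_reflect: "level (a - \<gamma>) (a - h) = - level \<gamma> h"
proof -
  define k where "k = h - \<gamma>"
  have k: "h - \<gamma> = k" "a - h - (a - \<gamma>) = - k" by (simp_all add: k_def)
  show ?thesis
  proof (cases "k mod 3 = 0")
    case True
    then have "(- k) mod 3 = 0" "(- k) div 3 = - (k div 3)" by presburger+
    with True show ?thesis by (simp add: level_def k)
  next
    case False
    then have "(- k) mod 3 \<noteq> 0" "(- k) div 3 = - (k div 3) - 1" by presburger+
    with False show ?thesis by (simp add: level_def k)
  qed
qed

lemma level_eq_1_iff: "level \<gamma> h = 1 \<longleftrightarrow> h = \<gamma> + 1 \<or> h = \<gamma> + 2"
proof -
  define k where "k = h - \<gamma>"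
  have "k = 3 * (k div 3) + k mod 3" "0 \<le> k mod 3" "k mod 3 < 3" by simp_all
  then have "2 * (k div 3) + of_bool (k mod 3 \<noteq> 0) = 1 \<longleftrightarrow> k = 1 \<or> k = 2"
    by (cases "k mod 3 = 0") (simp, presburger, simp, presburger)
  then show ?thesis by (auto simp: level_def k_def)
qed

lemma level_base [simp]: "level \<gamma> \<gamma> = 0" "level \<gamma> (\<gamma> + 3) = 2"
  by (simp_all add: level_def)

text \<open>Row \<open>i\<close> leads from height \<open>i\<close> to height \<open>n - i\<close>; a step is bad if the level moves against
  this direction. For \<open>2 * i = n\<close> the choice of sign is immaterial.\<close>

definition row_sign :: "nat \<Rightarrow> nat \<Rightarrow> int" where
  "row_sign n i = (if 2 * i \<le> n then 1 else -1)"

definition bad_steps :: "nat \<Rightarrow> int \<Rightarrow> (nat \<Rightarrow> nat \<Rightarrow> int) \<Rightarrow> (nat \<times> nat) set" where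
  "bad_steps n \<gamma> H = {(i, j). i \<le> n \<and> j < n \<and>
     row_sign n i * (level \<gamma> (H i (Suc j)) - level \<gamma> (H i j)) < 0}"

definition class_squares :: "nat \<Rightarrow> int \<Rightarrow> (nat \<Rightarrow> nat \<Rightarrow> int) \<Rightarrow> (nat \<times> nat) set" where
  "class_squares n \<gamma> H = {(i, j). i \<le> n \<and> j \<le> n \<and> in_class \<gamma> (H i j)}"

text \<open>Twice the minimal number of visits of row \<open>i\<close> to the class.\<close>

definition row_min :: "nat \<Rightarrow> int \<Rightarrow> nat \<Rightarrow> int" where
  "row_min n \<gamma> i = of_bool (in_class \<gamma> (int i)) + of_bool (in_class \<gamma> (int n - int i))
     + row_sign n i * (level \<gamma> (int n - int i) - level \<gamma> (int i))"

lemma finite_bad_steps [simp]: "finite (bad_steps n \<gamma> H)"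
  by (rule finite_subset[of _ "{..n} \<times> {..n}"]) (auto simp: bad_steps_def)

lemma finite_class_squares [simp]: "finite (class_squares n \<gamma> H)"
  by (rule finite_subset[of _ "{..n} \<times> {..n}"]) (auto simp: class_squares_def)

section \<open>Counting the squares of a class row by row\<close>

text \<open>At most one end of a step lies in the class. A step touching the class changes the level
  by one and contributes one half-visit; if it goes against \<open>\<sigma>\<close>, the signed
  level change is -1 instead of 1, and the bad step supplies the missing 2.\<close>

lemma walk_class_count:
  fixes w :: "nat \<Rightarrow> int"
  assumes "\<And>j. j < n \<Longrightarrow> w (Suc j) = w j + 1 \<or> w (Suc j) = w j - 1" "\<sigma> = 1 \<or> \<sigma> = -1"
  shows "2 * (\<Sum>j\<le>n. of_bool (in_class \<gamma> (w j)))
    = of_bool (in_class \<gamma> (w 0)) + of_bool (in_class \<gamma> (w n)) + \<sigma> * (level \<gamma> (w n) - level \<gamma> (w 0))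
      + 2 * (\<Sum>j<n. of_bool (\<sigma> * (level \<gamma> (w (Suc j)) - level \<gamma> (w j)) < 0))"
  using assms(1)
proof (induction n)
  case (Suc n)
  have "w (Suc n) = w n + 1 \<or> w (Suc n) = w n - 1" using Suc.prems by simp
  then have "of_bool (in_class \<gamma> (w (Suc n))) + of_bool (in_class \<gamma> (w n))
    = \<sigma> * (level \<gamma> (w (Suc n)) - level \<gamma> (w n))
      + 2 * of_bool (\<sigma> * (level \<gamma> (w (Suc n)) - level \<gamma> (w n)) < 0)"
    using assms(2) in_class_adjacent[of \<gamma> "w n"] by (auto simp: level_add_1 level_diff_1)
  then show ?case using Suc by (simp add: algebra_simps)
qed simp

lemma card_eq_sum_rows:
  fixes n m :: nat
  assumes "S \<subseteq> {..n} \<times> {..<m}"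
  shows "int (card S) = (\<Sum>i\<le>n. \<Sum>j<m. of_bool ((i, j) \<in> S))"
proof -
  have "int (card S) = (\<Sum>p\<in>{..n} \<times> {..<m}. of_bool (p \<in> S))"
    using assms by (simp add: Int_absorb1)
  then show ?thesis by (simp add: sum.cartesian_product split_def del: sum_of_bool_eq)
qed

text \<open>The ends of each row are prescribed, so the first sum is the same for all height
  functions and the bad steps measure the whole variation.\<close>

lemma card_class_squares:
  assumes "height_fun n H"
  shows "2 * int (card (class_squares n \<gamma> H)) = (\<Sum>i\<le>n. row_min n \<gamma> i) + 2 * int (card (bad_steps n \<gamma> H))"
proof -
  define V where "V i = (\<Sum>j\<le>n. of_bool (in_class \<gamma> (H i j)) :: int)" for i
  define W where
    "W i = (\<Sum>j<n. of_bool (row_sign n i * (level \<gamma> (H i (Suc j)) - level \<gamma> (H i j)) < 0) :: int)" for i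
  have row: "2 * V i = row_min n \<gamma> i + 2 * W i" if "i \<le> n" for i
    using walk_class_count[of n "H i" "row_sign n i" \<gamma>] height_funD[OF assms] that
    unfolding V_def W_def by (auto simp: row_min_def row_sign_def)
  have V: "int (card (class_squares n \<gamma> H)) = (\<Sum>i\<le>n. V i)"
    unfolding V_def by (subst card_eq_sum_rows[of _ n "Suc n"])
      (auto simp: class_squares_def lessThan_Suc_atMost simp del: sum_of_bool_eq intro!: sum.cong)
  have W: "int (card (bad_steps n \<gamma> H)) = (\<Sum>i\<le>n. W i)"
    unfolding W_def by (subst card_eq_sum_rows[of _ n n])
      (auto simp: bad_steps_def simp del: sum_of_bool_eq intro!: sum.cong)
  have "(\<Sum>i\<le>n. 2 * V i) = (\<Sum>i\<le>n. row_min n \<gamma> i + 2 * W i)"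
    by (rule sum.cong) (simp_all add: row)
  then show ?thesis
    unfolding V W by (simp add: sum.distrib flip: sum_distrib_left)
qed

subsection \<open>The minimal height function\<close>

lemma card_class_squares_transpose:
  "card (class_squares n \<gamma> (\<lambda>i j. H j i)) = card (class_squares n \<gamma> H)"
  by (rule bij_betw_same_card[of "\<lambda>(i, j). (j, i)"], rule bij_betwI[of _ _ _ "\<lambda>(i, j). (j, i)"])
    (auto simp: class_squares_def)

lemma card_class_squares_rotate:
  "card (class_squares n \<gamma> (\<lambda>i j. H (n - i) (n - j))) = card (class_squares n \<gamma> H)"
  by (rule bij_betw_same_card[of "\<lambda>(i, j). (n - i, n - j)"],
      rule bij_betwI[of _ _ _ "\<lambda>(i, j). (n - i, n - j)"])
    (auto simp: class_squares_def)

text \<open>There is no bijection between the bad row steps and the bad column steps behind this: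
  both numbers are the excess of the same number of squares over the same sum of row minima.\<close>

lemma card_bad_steps_transpose:
  assumes "height_fun n H"
  shows "card (bad_steps n \<gamma> (\<lambda>i j. H j i)) = card (bad_steps n \<gamma> H)"
  using card_class_squares[OF assms, of \<gamma>] card_class_squares[OF height_fun_transpose[OF assms], of \<gamma>]
    card_class_squares_transpose[of n \<gamma> H] by simp

lemma card_bad_steps_rotate:
  assumes "height_fun n H"
  shows "card (bad_steps n \<gamma> (\<lambda>i j. H (n - i) (n - j))) = card (bad_steps n \<gamma> H)"
  using card_class_squares[OF assms, of \<gamma>] card_class_squares[OF height_fun_rotate[OF assms], of \<gamma>]
    card_class_squares_rotate[of n \<gamma> H] by simp

lemma row_sign_cases: "row_sign n i = 1 \<or> row_sign n i = -1"
  by (simp add: row_sign_def)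

text \<open>A step that touches the class changes the level, so when it is not bad its direction is
  forced.\<close>

lemma good_step_from_class:
  assumes "height_fun n H" "i \<le> n" "j < n" "(i, j) \<notin> bad_steps n \<gamma> H"
  shows "in_class \<gamma> (H i j) \<Longrightarrow> H i (Suc j) = H i j + row_sign n i"
    "in_class \<gamma> (H i (Suc j)) \<Longrightarrow> H i (Suc j) = H i j + row_sign n i"
  using height_funD(1)[OF assms(1-3)] assms(2-) row_sign_cases[of n i]
  by (auto simp: bad_steps_def level_add_1 level_diff_1 of_bool_def split: if_splits)

definition minimal_height :: "nat \<Rightarrow> int \<Rightarrow> (nat \<Rightarrow> nat \<Rightarrow> int) \<Rightarrow> bool" where
  "minimal_height n \<gamma> H \<longleftrightarrow> height_fun n H \<and> bad_steps n \<gamma> H = {}"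

lemma minimal_height_transpose:
  "minimal_height n \<gamma> H \<Longrightarrow> minimal_height n \<gamma> (\<lambda>i j. H j i)"
  using card_bad_steps_transpose[of n H \<gamma>] by (auto simp: minimal_height_def height_fun_transpose)

lemma minimal_height_rotate:
  "minimal_height n \<gamma> H \<Longrightarrow> minimal_height n \<gamma> (\<lambda>i j. H (n - i) (n - j))"
  using card_bad_steps_rotate[of n H \<gamma>] by (auto simp: minimal_height_def height_fun_rotate)

text \<open>Reversing a row and negating the level each turn a step around; together they preserve
  good steps.\<close>

lemma minimal_height_reflect:
  assumes "minimal_height n \<gamma> H"
  shows "minimal_height n (int n - \<gamma>) (\<lambda>i j. int n - H i (n - j))"
proof -
  have "(i, n - Suc j) \<in> bad_steps n \<gamma> H"
    if "(i, j) \<in> bad_steps n (int n - \<gamma>) (\<lambda>i j. int n - H i (n - j))" for i j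
    using that by (auto simp: bad_steps_def level_reflect Suc_diff_Suc)
  then show ?thesis
    using assms height_fun_reflect[of n H] unfolding minimal_height_def by fast
qed

lemma level_mono_in_row:
  assumes "\<And>j. j < n \<Longrightarrow> (i, j) \<notin> bad_steps n \<gamma> H" "i \<le> n" "j \<le> k" "k \<le> n"
  shows "row_sign n i * level \<gamma> (H i j) \<le> row_sign n i * level \<gamma> (H i k)"
  using assms(3,4)
proof (induction k rule: dec_induct)
  case (step k)
  then have "(i, k) \<notin> bad_steps n \<gamma> H" using assms(1) by simp
  then have "0 \<le> row_sign n i * (level \<gamma> (H i (Suc k)) - level \<gamma> (H i k))"
    using step assms(2) by (auto simp: bad_steps_def)
  then show ?case using step by (simp add: algebra_simps)
qed simp

section \<open>Rigidity of minimal height functions\<close>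

text \<open>Induction down the antidiagonal. From a square of height \<open>h\<close> in the class,
  the row step into it and the column step out of it must both ascend, so its left neighbour has
  height \<open>h - 1\<close> and its lower neighbour \<open>h + 1\<close>. The next square of the
  antidiagonal is adjacent to both and has no choice.\<close>

lemma minimal_height_antidiagonal:
  assumes min: "minimal_height n \<gamma> H" and h: "in_class \<gamma> (int h)" "2 * h \<le> n" and "i \<le> h"
  shows "H i (h - i) = int h"
  using \<open>i \<le> h\<close>
proof (induction i)
  case 0
  then show ?case using min h height_funD(3)[of n H h] by (simp add: minimal_height_def)
next
  case (Suc i)
  have H: "height_fun n H" and HT: "height_fun n (\<lambda>i j. H j i)"
    and bad: "bad_steps n \<gamma> H = {}" "bad_steps n \<gamma> (\<lambda>i j. H j i) = {}"
    using min minimal_height_transpose[OF min] by (simp_all add: minimal_height_def)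
  define j where "j = h - Suc i"
  have j: "h - i = Suc j" "j < n" "Suc j \<le> n" "i < n" "2 * i \<le> n" "2 * Suc j \<le> n"
    using Suc.prems h by (simp_all add: j_def)
  have ij: "H i (Suc j) = int h" using Suc j by simp
  then have "H i j = int h - 1"
    using good_step_from_class(2)[OF H, of i j \<gamma>] h j bad by (simp add: row_sign_def)
  moreover have "H (Suc i) (Suc j) = int h + 1"
    using good_step_from_class(1)[OF HT, of "Suc j" i \<gamma>] h j bad ij by (simp add: row_sign_def)
  ultimately have "H (Suc i) j = int h"
    using height_funD(1)[OF H, of "Suc i" j] height_funD(2)[OF H, of i j] j by linarith
  then show ?case by (simp add: j_def)
qed

text \<open>Between two antidiagonals of the class the heights are pinned by slope: the border
  bounds them from above, the next class antidiagonal from below.\<close>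

lemma minimal_height_corner:
  assumes min: "minimal_height n \<gamma> H" and h: "in_class \<gamma> (int h)" "2 * h \<le> n" and ij: "i + j \<le> h"
  shows "H i j = int i + int j"
proof -
  have H: "height_fun n H" using min by (simp add: minimal_height_def)
  \<comment> \<open>The distance from \<open>(i, j)\<close> along its row to the next antidiagonal
    of the class.\<close>
  define d where "d = (h - (i + j)) mod 3"
  have d: "d \<le> h - (i + j)" by (simp add: d_def)
  have "int (i + j + d) = int h - 3 * int ((h - (i + j)) div 3)"
    using ij unfolding d_def by (simp add: modulo_nat_def of_nat_diff)
  then have "in_class \<gamma> (int (i + j + d))"
    using h(1) unfolding in_class_def by presburger
  then have "H i (i + j + d - i) = int (i + j + d)"
    using d ij h by (intro minimal_height_antidiagonal[OF min]) auto
  then have "H i (j + d) = int i + int j + int d" by (simp add: add.assoc)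
  moreover have "\<bar>H i (j + d) - H i j\<bar> \<le> int d" "\<bar>H i (0 + j) - H i 0\<bar> \<le> int j"
    using d ij h by (intro height_lipschitz[OF H]; simp)+
  moreover have "H i 0 = int i" using height_funD(4)[OF H, of i] ij h by simp
  ultimately show ?thesis by simp
qed

text \<open>Every height function lies between \<open>\<bar>i - j\<bar>\<close> and \<open>min (i + j) (2 * n - i - j)\<close>; the minimal one
  is the constant band \<open>g + 1\<close>, \<open>g + 2\<close> (alternating with the parity of the square) clipped to
  these bounds.\<close>

definition base_height :: "nat \<Rightarrow> int \<Rightarrow> nat \<Rightarrow> nat \<Rightarrow> int" where
  "base_height n g i j = max \<bar>int i - int j\<bar> (min (min (int i + int j) (2 * int n - int i - int j))
     (if even (int i + int j - g) then g + 2 else g + 1))"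

lemma base_height_rotate:
  assumes "i \<le> n" "j \<le> n"
  shows "base_height n g (n - i) (n - j) = base_height n g i j"
proof -
  have "int (n - i) + int (n - j) = 2 * int n - int i - int j"
    "2 * int n - int (n - i) - int (n - j) = int i + int j"
    "\<bar>int (n - i) - int (n - j)\<bar> = \<bar>int i - int j\<bar>" using assms by auto
  moreover have "even (2 * int n - int i - int j - g) = even (int i + int j - g)" by presburger
  ultimately show ?thesis
    by (simp only: base_height_def min.commute[of "int i + int j"])
qed

text \<open>Only the band needs an argument: on its rim a bound could cut off the value
  \<open>g + 2\<close> at \<open>g + 1\<close>, or lift \<open>g + 1\<close> to
  \<open>g + 2\<close>, but the bounds and the band have the same parity at every square.\<close>

lemma base_height_regions:
  assumes g: "2 * g + 1 \<le> int n" and ij: "i \<le> n" "j \<le> n"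
  shows "int i + int j \<le> g \<Longrightarrow> base_height n g i j = int i + int j"
    "2 * int n - int i - int j \<le> g \<Longrightarrow> base_height n g i j = 2 * int n - int i - int j"
    "g + 3 \<le> \<bar>int i - int j\<bar> \<Longrightarrow> base_height n g i j = \<bar>int i - int j\<bar>"
    "g < int i + int j \<Longrightarrow> g < 2 * int n - int i - int j \<Longrightarrow> \<bar>int i - int j\<bar> < g + 3 \<Longrightarrow>
      base_height n g i j = (if even (int i + int j - g) then g + 2 else g + 1)"
proof -
  show "int i + int j \<le> g \<Longrightarrow> base_height n g i j = int i + int j"
    "2 * int n - int i - int j \<le> g \<Longrightarrow> base_height n g i j = 2 * int n - int i - int j"
    "g + 3 \<le> \<bar>int i - int j\<bar> \<Longrightarrow> base_height n g i j = \<bar>int i - int j\<bar>"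
    using assms by (auto simp: base_height_def)
  assume *: "g < int i + int j" "g < 2 * int n - int i - int j" "\<bar>int i - int j\<bar> < g + 3"
  show "base_height n g i j = (if even (int i + int j - g) then g + 2 else g + 1)"
  proof (cases "even (int i + int j - g)")
    case True
    then have "int i + int j \<noteq> g + 1" "2 * int n - int i - int j \<noteq> g + 1" by presburger+
    with True * show ?thesis by (simp add: base_height_def)
  next
    case False
    then have "\<bar>int i - int j\<bar> \<noteq> g + 2" by presburger
    with False * show ?thesis by (simp add: base_height_def)
  qed
qed

text \<open>In the upper half \<open>i \<le> g + 1\<close> and \<open>n - i > g\<close>, so the
  bottom left and bottom right regions do not occur.\<close>

lemma base_height_top:
  assumes g: "2 * g + 1 \<le> int n" "int n \<le> 2 * g + 2" and i: "2 * i \<le> n" and j: "j \<le> n"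
  shows "int i + int j \<le> g \<Longrightarrow> base_height n g i j = int i + int j"
    "g + 3 \<le> int j - int i \<Longrightarrow> base_height n g i j = int j - int i"
    "g < int i + int j \<Longrightarrow> int j - int i < g + 3 \<Longrightarrow>
      base_height n g i j = (if even (int i + int j - g) then g + 2 else g + 1)"
proof -
  have "i \<le> n" using i by simp
  note regions = base_height_regions[OF g(1) this j]
  show "int i + int j \<le> g \<Longrightarrow> base_height n g i j = int i + int j" by (rule regions(1))
  show "g + 3 \<le> int j - int i \<Longrightarrow> base_height n g i j = int j - int i" using regions(3) g by simp
  show "g < int i + int j \<Longrightarrow> int j - int i < g + 3 \<Longrightarrow>
      base_height n g i j = (if even (int i + int j - g) then g + 2 else g + 1)"
    using assms by (intro regions(4)) linarith+
qed

text \<open>The two corners are rigid. Between them the level is squeezed: the step leaving height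
  \<open>g\<close> raises it to 1, the step entering height \<open>g + 3\<close> has to start from
  level 1, and it is monotone along the row. Level 1 leaves the heights \<open>g + 1\<close> and
  \<open>g + 2\<close>, and parity decides.\<close>

lemma minimal_height_unique_top:
  assumes g: "2 * g + 1 \<le> int n" "int n \<le> 2 * g + 2" and min: "minimal_height n g H"
    and i: "2 * i \<le> n" and j: "j \<le> n"
  shows "H i j = base_height n g i j"
proof -
  have H: "height_fun n H" and bad: "bad_steps n g H = {}"
    using min by (simp_all add: minimal_height_def)
  have mono: "level g (H i a) \<le> level g (H i b)" if "a \<le> b" "b \<le> n" for a b
    using level_mono_in_row[of n i g H a b] bad i that by (simp add: row_sign_def)
  have corner1: "H i k = int i + int k" if "int i + int k \<le> g" for k
    using that g by (intro minimal_height_corner[OF min, of "nat g"]) (auto simp: in_class_def)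
  have corner2: "H i k = int k - int i" if "g + 3 \<le> int k - int i" "k \<le> n" for k
  proof -
    have "int n - H i (n - (n - k)) = int i + int (n - k)"
      using that g
      \<comment> \<open>Height \<open>g + 3\<close>, the next member of the class above
        \<open>g\<close>, becomes \<open>n - g - 3\<close> under the reflection.\<close>
      by (intro minimal_height_corner[OF minimal_height_reflect[OF min], of "nat (int n - g - 3)"])
        (auto simp: in_class_def)
    then show ?thesis using that by simp
  qed
  consider "int i + int j \<le> g" | "g + 3 \<le> int j - int i" | "g < int i + int j" "int j - int i < g + 3"
    by linarith
  then show ?thesis
  proof cases
    case 1
    then show ?thesis using corner1[of j] base_height_top(1)[OF g i j] by simp
  next
    case 2
    then show ?thesis using corner2[of j] j base_height_top(2)[OF g i j] by simp
  next
    case 3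
    have "1 \<le> level g (H i j)"
    proof (cases "int i \<le> g")
      case True
      define k where "k = nat (g - int i)"
      have k: "int k = g - int i" "k < n" "Suc k \<le> j" using True 3 g by (auto simp: k_def)
      have "H i k = g" using corner1[of k] k by simp
      then have "H i (Suc k) = g + 1"
        using good_step_from_class(1)[OF H, of i k g] k bad i by (simp add: in_class_def row_sign_def)
      then show ?thesis using mono[of "Suc k" j] k j level_eq_1_iff[of g "g + 1"] by simp
    next
      case False
      then have "int i = g + 1" using i g by linarith
      then show ?thesis
        using mono[of 0 j] j level_eq_1_iff[of g "g + 1"] height_funD(4)[OF H, of i] i by simp
    qed
    moreover have "level g (H i j) \<le> 1"
    proof (cases "int i + g + 3 \<le> int n")
      case True
      \<comment> \<open>The last column before the right corner region, whose first height in this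
        row is \<open>g + 3\<close>.\<close>
      define k where "k = nat (int i + g + 2)"
      have k: "int k = int i + g + 2" "k < n" "j \<le> k" using True 3 g by (auto simp: k_def)
      have "H i (Suc k) = g + 3" using corner2[of "Suc k"] k by simp
      then have "H i k = g + 2"
        using good_step_from_class(2)[OF H, of i k g] k bad i by (simp add: in_class_def row_sign_def)
      then show ?thesis using mono[of j k] k level_eq_1_iff[of g "g + 2"] by simp
    next
      case False
      then have "level g (H i n) \<le> level g (g + 2)"
        using height_funD(6)[OF H, of i] i by (intro level_mono) simp
      then show ?thesis using mono[of j n] j level_eq_1_iff[of g "g + 2"] by simp
    qed
    ultimately have "H i j = g + 1 \<or> H i j = g + 2" by (simp flip: level_eq_1_iff)
    moreover have "even (H i j - int i - int j)" using height_parity[OF H, of i j] i j by simp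
    ultimately have "H i j = (if even (int i + int j - g) then g + 2 else g + 1)" by auto
    then show ?thesis using base_height_top(3)[OF g i j] 3 by simp
  qed
qed

lemma minimal_height_unique:
  assumes g: "2 * g + 1 \<le> int n" "int n \<le> 2 * g + 2" and min: "minimal_height n g H"
    and "i \<le> n" and "j \<le> n"
  shows "H i j = base_height n g i j"
proof (cases "2 * i \<le> n")
  case True
  then show ?thesis using minimal_height_unique_top[OF g min] assms by simp
next
  case False
  have "H (n - (n - i)) (n - (n - j)) = base_height n g (n - i) (n - j)"
    using minimal_height_unique_top[OF g minimal_height_rotate[OF min], of "n - i" "n - j"] False by simp
  then show ?thesis using base_height_rotate assms by simp
qed

section \<open>Existence of the minimal height function\<close>

text \<open>Two walks with unit steps and equal parity are either equal or at least 2 apart, so they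
  cannot cross without meeting. Hence clipping one by the other keeps unit steps.\<close>

lemma max_min_parity_step:
  fixes x y :: int
  assumes "even (x - y)" "\<bar>x' - x\<bar> = 1" "\<bar>y' - y\<bar> = 1"
  shows "\<bar>max x' y' - max x y\<bar> = 1" "\<bar>min x' y' - min x y\<bar> = 1"
proof -
  have "x = y \<or> x + 2 \<le> y \<or> y + 2 \<le> x" using assms(1) by presburger
  then show "\<bar>max x' y' - max x y\<bar> = 1" "\<bar>min x' y' - min x y\<bar> = 1"
    using assms(2,3) by (auto simp: max_def min_def split: if_splits)
qed

lemma height_fun_base:
  assumes g: "2 * g + 1 \<le> int n" "int n \<le> 2 * g + 2"
  shows "height_fun n (base_height n g)"
proof -
  have step: "\<bar>base_height n g i (Suc j) - base_height n g i j\<bar> = 1" for i j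
  proof -
    define a b c d where "a k = \<bar>int i - int k\<bar>" and "b k = int i + int k"
      and "c k = 2 * int n - int i - int k"
      and "d k = (if even (int i + int k - g) then g + 2 else g + 1)" for k :: nat
    have "\<bar>a (Suc j) - a j\<bar> = 1" "\<bar>b (Suc j) - b j\<bar> = 1" "\<bar>c (Suc j) - c j\<bar> = 1" "\<bar>d (Suc j) - d j\<bar> = 1"
      by (auto simp: a_def b_def c_def d_def abs_if)
    moreover have par: "even (a j - int i - int j)" "even (b j - int i - int j)" "even (c j - int i - int j)"
      "even (d j - int i - int j)"
      by (auto simp: a_def b_def c_def d_def abs_if)
    moreover have "even (b j - c j)" "even (min (b j) (c j) - d j)" "even (a j - min (min (b j) (c j)) (d j))"
      using par by (auto simp: min_def)
    ultimately have "\<bar>max (a (Suc j)) (min (min (b (Suc j)) (c (Suc j))) (d (Suc j)))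
        - max (a j) (min (min (b j) (c j)) (d j))\<bar> = 1"
      by (intro max_min_parity_step)
    then show ?thesis by (simp only: base_height_def a_def b_def c_def d_def)
  qed
  have sym: "base_height n g i j = base_height n g j i" for i j
  proof -
    have "int i + int j = int j + int i" "2 * int n - int i - int j = 2 * int n - int j - int i"
      "\<bar>int i - int j\<bar> = \<bar>int j - int i\<bar>" by simp_all
    then show ?thesis unfolding base_height_def by metis
  qed
  have "base_height n g 0 k = int k" "base_height n g n k = int n - int k" if "k \<le> n" for k
    using that g unfolding base_height_def by (simp_all add: max_def min_def)
  then show ?thesis
    unfolding height_fun_def using step sym by metis
qed

text \<open>In the upper half a row climbs to \<open>g\<close>, stays in the band at constant level
  1 and climbs on from \<open>g + 3\<close>, so its level never falls. The half-turn gives the lower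
  half.\<close>

lemma minimal_height_base:
  assumes g: "2 * g + 1 \<le> int n" "int n \<le> 2 * g + 2"
  shows "minimal_height n g (base_height n g)"
proof -
  have top: "level g (base_height n g i j) \<le> level g (base_height n g i (Suc j))"
    if "2 * i \<le> n" "j < n" for i j
  proof -
    have lev: "level g (g + 1) = 1" "level g (g + 2) = 1" by (simp_all add: level_eq_1_iff)
    consider "int i + int (Suc j) \<le> g" | "int i + int j \<le> g" "g < int i + int (Suc j)"
      | "g < int i + int j" "int j - int i < g + 3" | "g + 3 \<le> int j - int i" by linarith
    then show ?thesis
    proof cases
      case 1
      then show ?thesis using base_height_top(1)[OF g, of i j] base_height_top(1)[OF g, of i "Suc j"] that
        by (auto intro: level_mono)
    next
      case 2
      then show ?thesis
        using base_height_top(1)[OF g, of i j] base_height_top(3)[OF g, of i "Suc j"] that lev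
          level_mono[of "int i + int j" g g] by auto
    next
      case 3
      then have *: "level g (base_height n g i j) = 1"
        using base_height_top(3)[OF g, of i j] that lev by simp
      show ?thesis
      proof (cases "int (Suc j) - int i < g + 3")
        case True
        then show ?thesis using 3 * base_height_top(3)[OF g, of i "Suc j"] that lev by simp
      next
        case False
        then show ?thesis using 3 * base_height_top(2)[OF g, of i "Suc j"] that
            level_mono[of "g + 3" "int (Suc j) - int i" g] by simp
      qed
    next
      case 4
      then show ?thesis using base_height_top(2)[OF g, of i j] base_height_top(2)[OF g, of i "Suc j"] that
        by (auto intro: level_mono)
    qed
  qed
  have "level g (base_height n g i (Suc j)) \<le> level g (base_height n g i j)"
    if "\<not> 2 * i \<le> n" "i \<le> n" "j < n" for i j
    using top[of "n - i" "n - Suc j"] that base_height_rotate[of i n "Suc j" g] base_height_rotate[of i n j g]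
    by (simp add: Suc_diff_Suc)
  with top have "bad_steps n g (base_height n g) = {}"
    by (fastforce simp: bad_steps_def row_sign_def)
  then show ?thesis using height_fun_base[OF g] by (simp add: minimal_height_def)
qed

subsection \<open>Height functions with one bad step\<close>

lemma bad_step_top:
  assumes H: "height_fun n H" and bad: "(i, j) \<in> bad_steps n \<gamma> H" and i: "2 * i \<le> n"
  shows "H i (Suc j) = H i j - 1" "in_class \<gamma> (H i j) \<or> in_class \<gamma> (H i (Suc j))"
proof -
  have *: "i \<le> n" "j < n" "level \<gamma> (H i (Suc j)) < level \<gamma> (H i j)"
    using bad i by (auto simp: bad_steps_def row_sign_def)
  show "H i (Suc j) = H i j - 1"
    using height_funD(1)[OF H *(1,2)] *(3) level_mono[of "H i j" "H i j + 1" \<gamma>] by auto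
  then show "in_class \<gamma> (H i j) \<or> in_class \<gamma> (H i (Suc j))"
    using *(3) by (auto simp: level_diff_1 of_bool_def split: if_splits)
qed

text \<open>If the neighbour above or below a row extremum lay on the other side, its row would turn
  around between two squares of the class, which costs a further bad step.\<close>

lemma row_extremum_is_extremum:
  assumes H: "height_fun n H" and ik: "k = Suc i \<or> i = Suc k" "i \<le> n" "k \<le> n" and j: "Suc j < n"
    and h: "in_class \<gamma> h" "H i (Suc j) = h" "H i j = h + \<tau>" "H i (Suc (Suc j)) = h + \<tau>"
    and \<tau>: "\<tau> = 1 \<or> \<tau> = -1"
    and good: "(k, j) \<notin> bad_steps n \<gamma> H" "(k, Suc j) \<notin> bad_steps n \<gamma> H"
  shows "H k (Suc j) = h + \<tau>"
proof (rule ccontr)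
  have adj: "H k a = H i a + 1 \<or> H k a = H i a - 1" if "a \<le> n" for a
    using ik height_funD(2)[OF H, of i a] height_funD(2)[OF H, of k a] that by auto
  assume "H k (Suc j) \<noteq> h + \<tau>"
  then have mid: "H k (Suc j) = h - \<tau>" using adj[of "Suc j"] h \<tau> j by force
  have "H k j = h + \<tau> + 1 \<or> H k j = h + \<tau> - 1"
    "H k (Suc (Suc j)) = h + \<tau> + 1 \<or> H k (Suc (Suc j)) = h + \<tau> - 1"
    using adj[of j] adj[of "Suc (Suc j)"] h j by simp_all
  moreover have "H k j = h - \<tau> + 1 \<or> H k j = h - \<tau> - 1"
    "H k (Suc (Suc j)) = h - \<tau> + 1 \<or> H k (Suc (Suc j)) = h - \<tau> - 1"
    using height_funD(1)[OF H, of k j] height_funD(1)[OF H, of k "Suc j"] mid j ik by force+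
  ultimately have *: "H k j = h" "H k (Suc (Suc j)) = h" using \<tau> by linarith+
  have "H k (Suc j) = h + row_sign n k"
    using good_step_from_class(1)[OF H ik(3) _ good(1)] * h j by simp
  moreover have "h = H k (Suc j) + row_sign n k"
    using good_step_from_class(2)[OF H ik(3) _ good(2)] * h j by simp
  ultimately show False using row_sign_cases[of n k] by linarith
qed

text \<open>The bad step descends into or out of the class. The step on the other side of its class
  square is good, hence ascends, so that square is an extremum of its row, and then of its column.
  It remains to exclude class squares on the border.\<close>

lemma single_bad_step_top:
  assumes n: "n = 2 * p + 1" and H: "height_fun n H"
    and bad: "bad_steps n (int p) H = {(i, j)}" and i: "2 * i \<le> n"
  obtains a b \<tau> where "Suc a < n" "Suc b < n" "in_class (int p) (H (Suc a) (Suc b))" "\<tau> = 1 \<or> \<tau> = -1"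
    "\<forall>(k, l) \<in> {(a, Suc b), (Suc (Suc a), Suc b), (Suc a, b), (Suc a, Suc (Suc b))}.
       H k l = H (Suc a) (Suc b) + \<tau>"
proof -
  note result = that
  have ij: "i \<le> n" "j < n" "(i, j) \<in> bad_steps n (int p) H" using bad by (auto simp: bad_steps_def)
  have good: "(k, l) \<notin> bad_steps n (int p) H" if "k \<noteq> i \<or> l \<noteq> j" for k l using that bad by auto
  note step = bad_step_top[OF H ij(3) i]
  have i0: "0 < i" using step(1) height_funD(3)[OF H, of j] height_funD(3)[OF H, of "Suc j"] ij
    by (cases i) auto
  have ip: "i \<le> p" "Suc i \<le> n" using n i i0 by auto
  have fin: thesis if b: "Suc b < n" "in_class (int p) (H i (Suc b))" "\<tau> = 1 \<or> \<tau> = -1"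
    "H i b = H i (Suc b) + \<tau>" "H i (Suc (Suc b)) = H i (Suc b) + \<tau>" for b \<tau>
  proof -
    obtain a where a: "i = Suc a" using i0 by (cases i) auto
    have up: "H a (Suc b) = H i (Suc b) + \<tau>"
      by (rule row_extremum_is_extremum[OF H, of a i b "int p"]) (use b a ij good in auto)
    have dn: "H (Suc i) (Suc b) = H i (Suc b) + \<tau>"
      by (rule row_extremum_is_extremum[OF H, of "Suc i" i b "int p"]) (use b a ip good in auto)
    show thesis
      using result[of a b \<tau>] b up dn a ip n by simp
  qed
  have last: "Suc i \<le> p \<or> i = p" using ip by auto
  show thesis
  proof (cases "in_class (int p) (H i (Suc j))")
    case c: True
    show thesis
    proof (cases "Suc j < n")
      case True
      have e: "H i j = H i (Suc j) + 1" using step(1) by linarith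
      have "H i (Suc (Suc j)) = H i (Suc j) + 1"
        using good_step_from_class(1)[OF H, of i "Suc j" "int p"] c True good ij i by (simp add: row_sign_def)
      from fin[OF True c _ e this] show thesis by simp
    next
      case False
      \<comment> \<open>A descent ending at the right border forces the last step of the next row to
        descend out of the class. As \<open>i < p\<close>, that row is still in the upper half, and
        this is a second bad step.\<close>
      then have j: "Suc j = n" using ij by simp
      have "H i n = int n - int i" "H (Suc i) n = int n - int i - 1"
        using height_funD(6)[OF H] ip by simp_all
      then have "H i (Suc j) = int n - int i" "H (Suc i) (Suc j) = int n - int i - 1"
        using j by simp_all
      moreover from this have "H (Suc i) j = int n - int i"
        using height_funD(1)[OF H, of "Suc i" j] height_funD(2)[OF H, of i j] step ij ip by linarith
      moreover have "i \<noteq> p"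
        using c \<open>H i (Suc j) = int n - int i\<close> n by (auto simp: in_class_def)
      ultimately have False
        using good_step_from_class(1)[OF H, of "Suc i" j "int p"] good[of "Suc i" j] c ij ip last n
        by (simp add: row_sign_def)
      then show thesis ..
    qed
  next
    case False
    then have c: "in_class (int p) (H i j)" using step by simp
    show thesis
    proof (cases j)
      case (Suc l)
      have e: "H i (Suc (Suc l)) = H i (Suc l) + - 1" using step(1) Suc by simp
      have "H i (Suc l) = H i l + 1"
        using good_step_from_class(2)[OF H, of i l "int p"] c good[of i l] ij i Suc by (simp add: row_sign_def)
      then have "H i l = H i (Suc l) + - 1" by linarith
      from fin[OF _ _ _ this e] show thesis using c Suc ij by simp
    next
      case 0
      \<comment> \<open>A descent starting at the left border is repeated one row lower, again a
        second bad step as long as \<open>i < p\<close>. For \<open>i = p\<close> the next row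
        belongs to the lower half: it must leave height \<open>p\<close> downwards and, without bad
        steps, cannot return to its final height \<open>p\<close>.\<close>
      have h: "H i 0 = int i" "H (Suc i) 0 = int i + 1"
        using height_funD(4)[OF H] ip by simp_all
      then have h1: "H (Suc i) 1 = int i"
        using height_funD(1)[OF H, of "Suc i" 0] height_funD(2)[OF H, of i 1] step ij ip 0 by auto
      show thesis
      proof (cases "i = p")
        case False
        then have False
          using good_step_from_class(2)[OF H, of "Suc i" 0 "int p"] good[of "Suc i" 0] c ij ip last n h h1 0
          by (simp add: row_sign_def)
        then show thesis ..
      next
        case True
        have sg: "row_sign n (Suc i) = -1" using True n by (simp add: row_sign_def)
        have n2: "2 \<le> n" using n i0 True by simp
        have "H (Suc i) 2 = int p - 1"
          using good_step_from_class(1)[OF H, of "Suc i" 1 "int p"] good[of "Suc i" 1] c n2 ip True h h1 0 sg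
          by (simp add: numeral_2_eq_2)
        then have "level (int p) (H (Suc i) 2) \<le> -1"
          using level_diff_1[of "int p" "int p"] by (simp add: in_class_def)
        moreover have "H (Suc i) n = int p" using height_funD(6)[OF H, of "Suc i"] ip n True by simp
        ultimately have False
          using level_mono_in_row[of n "Suc i" "int p" H 2 n] good[of "Suc i"] n2 sg ip by simp
        then show thesis ..
      qed
    qed
  qed
qed

lemma single_bad_step:
  assumes n: "n = 2 * p + 1" and H: "height_fun n H" and "card (bad_steps n (int p) H) = 1"
  obtains a b \<tau> where "Suc a < n" "Suc b < n" "in_class (int p) (H (Suc a) (Suc b))" "\<tau> = 1 \<or> \<tau> = -1"
    "\<forall>(k, l) \<in> {(a, Suc b), (Suc (Suc a), Suc b), (Suc a, b), (Suc a, Suc (Suc b))}.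
       H k l = H (Suc a) (Suc b) + \<tau>"
proof -
  obtain i j where ij: "bad_steps n (int p) H = {(i, j)}"
    using assms(3) by (metis card_1_singletonE surj_pair)
  show thesis
  proof (cases "2 * i \<le> n")
    case True
    show thesis by (rule single_bad_step_top[OF n H ij True]) (rule that)
  next
    case False
    let ?H = "\<lambda>i j. H (n - i) (n - j)"
    have "(i, j) \<in> bad_steps n (int p) H" using ij by simp
    then have "(n - i, n - Suc j) \<in> bad_steps n (int p) ?H"
      using False by (auto simp: bad_steps_def row_sign_def Suc_diff_Suc)
    moreover have "card (bad_steps n (int p) ?H) = 1" using card_bad_steps_rotate[OF H] assms(3) by simp
    ultimately have "bad_steps n (int p) ?H = {(n - i, n - Suc j)}"
      by (metis card_1_singletonE singletonD)
    moreover have "2 * (n - i) \<le> n" using False by simp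
    ultimately obtain a b \<tau> where *: "Suc a < n" "Suc b < n" "in_class (int p) (?H (Suc a) (Suc b))"
      "\<tau> = 1 \<or> \<tau> = -1"
      "\<forall>(k, l) \<in> {(a, Suc b), (Suc (Suc a), Suc b), (Suc a, b), (Suc a, Suc (Suc b))}.
       ?H k l = ?H (Suc a) (Suc b) + \<tau>"
      by (rule single_bad_step_top[OF n height_fun_rotate[OF H]])
    define a' b' where "a' = n - Suc (Suc a)" and "b' = n - Suc (Suc b)"
    have "n - Suc a = Suc a'" "n - Suc b = Suc b'" "n - a = Suc (Suc a')" "n - b = Suc (Suc b')"
      "n - Suc (Suc a) = a'" "n - Suc (Suc b) = b'" "Suc a' < n" "Suc b' < n"
      using *(1,2) by (auto simp: a'_def b'_def)
    then show thesis using that[of a' b' \<tau>] * by auto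
  qed
qed

section \<open>Flipping a single square\<close>

definition flip_height :: "(nat \<Rightarrow> nat \<Rightarrow> int) \<Rightarrow> nat \<Rightarrow> nat \<Rightarrow> int \<Rightarrow> nat \<Rightarrow> nat \<Rightarrow> int" where
  "flip_height H i j h = (\<lambda>a b. if a = i \<and> b = j then h else H a b)"

lemma height_fun_flip:
  assumes H: "height_fun n H" and ij: "0 < i" "i < n" "0 < j" "j < n" and \<tau>: "\<tau> = 1 \<or> \<tau> = -1"
    and nb: "\<forall>(k, l) \<in> {(i - 1, j), (Suc i, j), (i, j - 1), (i, Suc j)}. H k l = H i j + \<tau>"
  shows "height_fun n (flip_height H i j (H i j + 2 * \<tau>))"
proof -
  let ?F = "flip_height H i j (H i j + 2 * \<tau>)"
  have "\<bar>?F a (Suc b) - ?F a b\<bar> = 1" if "a \<le> n" "b < n" for a b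
  proof -
    consider "a = i" "Suc b = j" | "a = i" "b = j" | "a \<noteq> i \<or> (Suc b \<noteq> j \<and> b \<noteq> j)" by blast
    then show ?thesis
      by cases (use nb \<tau> height_funD(1)[OF H that] in \<open>auto simp: flip_height_def\<close>)
  qed
  moreover have "\<bar>?F (Suc a) b - ?F a b\<bar> = 1" if "a < n" "b \<le> n" for a b
  proof -
    consider "b = j" "Suc a = i" | "b = j" "a = i" | "b \<noteq> j \<or> (Suc a \<noteq> i \<and> a \<noteq> i)" by blast
    then show ?thesis
      by cases (use nb \<tau> height_funD(2)[OF H that] in \<open>auto simp: flip_height_def\<close>)
  qed
  moreover have "?F 0 k = int k \<and> ?F k 0 = int k \<and> ?F n k = int n - int k \<and> ?F k n = int n - int k"
    if "k \<le> n" for k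
    using height_funD(3-6)[OF H that] ij by (simp add: flip_height_def)
  ultimately show ?thesis by (simp add: height_fun_def)
qed

text \<open>Of the two heights next to a height outside the class exactly one is in the class. If no
  neighbour is in the class, all four therefore agree: these are the local extrema of the base
  height whose flip creates one new class square.\<close>

definition flip_sites :: "nat \<Rightarrow> int \<Rightarrow> (nat \<times> nat) set" where
  "flip_sites n g = {(i, j). 0 < i \<and> i < n \<and> 0 < j \<and> j < n \<and>
     (\<forall>(k, l) \<in> {(i, j), (i - 1, j), (Suc i, j), (i, j - 1), (i, Suc j)}. \<not> in_class g (base_height n g k l))}"

text \<open>The flip goes over the common height of the neighbours; for residue 1 they lie above,
  for residue 2 below, and the new height falls into the class.\<close>

definition excited_height :: "nat \<Rightarrow> int \<Rightarrow> nat \<times> nat \<Rightarrow> nat \<Rightarrow> nat \<Rightarrow> int" where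
  "excited_height n g = (\<lambda>(i, j). flip_height (base_height n g) i j
     (base_height n g i j + (if (base_height n g i j - g) mod 3 = 1 then 2 else -2)))"

lemma card_bad_steps_diff:
  assumes "height_fun n H" "height_fun n K"
  shows "int (card (bad_steps n \<gamma> H)) - int (card (bad_steps n \<gamma> K))
    = int (card (class_squares n \<gamma> H)) - int (card (class_squares n \<gamma> K))"
  using card_class_squares[OF assms(1), of \<gamma>] card_class_squares[OF assms(2), of \<gamma>] by simp

text \<open>The flipped square joins the class and no other square changes, so the excess over the
  minimum, which is the number of bad steps, rises from 0 to 1.\<close>

lemma excited_height:
  assumes g: "2 * g + 1 \<le> int n" "int n \<le> 2 * g + 2" and s: "s \<in> flip_sites n g"
  shows "height_fun n (excited_height n g s)" "card (bad_steps n g (excited_height n g s)) = 1"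
proof -
  let ?B = "base_height n g"
  obtain i j where ij: "s = (i, j)" by (cases s)
  have B: "height_fun n ?B" and bad: "bad_steps n g ?B = {}"
    using minimal_height_base[OF g] by (simp_all add: minimal_height_def)
  have pos: "0 < i" "i < n" "0 < j" "j < n" and nc: "\<not> in_class g (?B i j)"
    and nb: "\<forall>(k, l) \<in> {(i - 1, j), (Suc i, j), (i, j - 1), (i, Suc j)}. \<not> in_class g (?B k l)"
    using s by (auto simp: flip_sites_def ij)
  define \<tau> :: int where "\<tau> = (if (?B i j - g) mod 3 = 1 then 1 else -1)"
  have c: "in_class g (?B i j - \<tau>)" "in_class g (?B i j + 2 * \<tau>)"
    using nc unfolding in_class_def \<tau>_def by presburger+
  have "?B k l = ?B i j + \<tau>" if "(k, l) \<in> {(i - 1, j), (Suc i, j), (i, j - 1), (i, Suc j)}" for k l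
  proof -
    have "\<bar>?B k l - ?B i j\<bar> = 1"
    proof -
      obtain a b where ab: "i = Suc a" "j = Suc b" using pos by (metis gr0_implies_Suc)
      have "\<bar>?B i (Suc j) - ?B i j\<bar> = 1" "\<bar>?B i j - ?B i b\<bar> = 1" "\<bar>?B (Suc i) j - ?B i j\<bar> = 1"
        "\<bar>?B i j - ?B a j\<bar> = 1"
        using B pos unfolding height_fun_def ab by simp_all
      then show ?thesis using that by (auto simp: ab abs_minus_commute)
    qed
    then have "?B k l = ?B i j + \<tau> \<or> ?B k l = ?B i j - \<tau>" by (auto simp: \<tau>_def)
    moreover have "\<not> in_class g (?B k l)" using nb that by blast
    ultimately show ?thesis using c(1) by auto
  qed
  then have "height_fun n (flip_height ?B i j (?B i j + 2 * \<tau>))"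
    by (intro height_fun_flip[OF B pos]) (auto simp: \<tau>_def)
  moreover have e: "excited_height n g s = flip_height ?B i j (?B i j + 2 * \<tau>)"
    by (simp add: excited_height_def ij \<tau>_def)
  ultimately show E: "height_fun n (excited_height n g s)" by simp
  have "class_squares n g (excited_height n g s) = insert (i, j) (class_squares n g ?B)"
    unfolding e using c(2) pos by (auto simp: class_squares_def flip_height_def)
  moreover have "(i, j) \<notin> class_squares n g ?B" using nc by (simp add: class_squares_def)
  ultimately show "card (bad_steps n g (excited_height n g s)) = 1"
    using card_bad_steps_diff[OF E B, of g] bad by simp
qed

text \<open>The class extremum found above can be flipped out of the class. This removes one square
  from the class, hence the only bad step, and uniqueness identifies the result with the base
  height.\<close>

lemma excess_one_is_excited:
  assumes n: "n = 2 * p + 1" and H: "height_fun n H" and "card (bad_steps n (int p) H) = 1"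
  obtains s where "s \<in> flip_sites n (int p)"
    "\<And>i j. i \<le> n \<Longrightarrow> j \<le> n \<Longrightarrow> H i j = excited_height n (int p) s i j"
proof -
  let ?g = "int p"
  have g: "2 * ?g + 1 \<le> int n" "int n \<le> 2 * ?g + 2" using n by simp_all
  obtain a b \<tau> where ab: "Suc a < n" "Suc b < n" and c: "in_class ?g (H (Suc a) (Suc b))"
    and \<tau>: "\<tau> = 1 \<or> \<tau> = -1" and
    nb: "\<forall>(k, l) \<in> {(a, Suc b), (Suc (Suc a), Suc b), (Suc a, b), (Suc a, Suc (Suc b))}.
       H k l = H (Suc a) (Suc b) + \<tau>"
    by (rule single_bad_step[OF assms])
  define h where "h = H (Suc a) (Suc b)"
  let ?K = "flip_height H (Suc a) (Suc b) (h + 2 * \<tau>)"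
  have K: "height_fun n ?K"
    unfolding h_def using ab nb by (intro height_fun_flip[OF H _ _ _ _ \<tau>]) auto
  have nc: "\<not> in_class ?g (h + \<tau>)" "\<not> in_class ?g (h + 2 * \<tau>)"
    using c \<tau> unfolding in_class_def h_def by (auto; presburger)+
  have "class_squares n ?g H = insert (Suc a, Suc b) (class_squares n ?g ?K)"
    using c nc ab by (auto simp: class_squares_def flip_height_def h_def)
  moreover have "(Suc a, Suc b) \<notin> class_squares n ?g ?K"
    using nc by (simp add: class_squares_def flip_height_def)
  ultimately have "card (bad_steps n ?g ?K) = 0"
    using card_bad_steps_diff[OF H K, of ?g] assms(3) by simp
  then have min: "minimal_height n ?g ?K" using K by (simp add: minimal_height_def)
  have B: "base_height n ?g i j = ?K i j" if "i \<le> n" "j \<le> n" for i j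
    using minimal_height_unique[OF g min that] by simp
  have B0: "base_height n ?g (Suc a) (Suc b) = h + 2 * \<tau>"
    using B[of "Suc a" "Suc b"] ab by (simp add: flip_height_def)
  have "(Suc a, Suc b) \<in> flip_sites n ?g"
    using ab nc nb unfolding flip_sites_def h_def[symmetric]
    by (auto simp: B flip_height_def)
  moreover have "H i j = excited_height n ?g (Suc a, Suc b) i j" if "i \<le> n" "j \<le> n" for i j
  proof (cases "i = Suc a \<and> j = Suc b")
    case True
    have "(if (h + 2 * \<tau> - ?g) mod 3 = 1 then 2 else -2) = - 2 * \<tau>"
      using \<tau> c unfolding in_class_def h_def[symmetric] by (auto; presburger)
    then show ?thesis using True by (simp add: excited_height_def flip_height_def B0 h_def)
  next
    case False
    then have "H i j = ?K i j" by (auto simp: flip_height_def)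
    with False show ?thesis using B[OF that] by (auto simp: excited_height_def flip_height_def)
  qed
  ultimately show thesis by (rule that)
qed

section \<open>The flippable squares\<close>

text \<open>Inside the rectangle a square and its four neighbours lie in the band. Beyond a side the
  surface is sloped, so the square and two opposite neighbours would have three consecutive heights,
  one of them in the class. Where the slope already meets the band, the values that are missing are
  \<open>p + 1\<close> or \<open>p + 2\<close>, which are not in the class, so the contradiction
  persists.\<close>

lemma flip_sites_odd:
  assumes n: "n = 2 * p + 1"
  shows "flip_sites n (int p) = {(i, j). i \<le> j + p + 1 \<and> j \<le> i + p + 1 \<and> p + 2 \<le> i + j \<and> i + j \<le> 3 * p}"
    (is "?S = ?R")
proof (intro equalityI subsetI)
  let ?g = "int p"
  have g: "2 * ?g + 1 \<le> int n" using n by simp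
  note reg = base_height_regions[OF g]
  fix s assume "s \<in> ?R"
  then obtain i j where s: "s = (i, j)" and
    R: "i \<le> j + p + 1" "j \<le> i + p + 1" "p + 2 \<le> i + j" "i + j \<le> 3 * p" by auto
  then have pos: "0 < i" "i < n" "0 < j" "j < n" using n by auto
  have "\<not> in_class ?g (base_height n ?g k l)"
    if "(k, l) \<in> {(i, j), (i - 1, j), (Suc i, j), (i, j - 1), (i, Suc j)}" for k l
  proof -
    have "base_height n ?g k l = (if even (int k + int l - ?g) then ?g + 2 else ?g + 1)"
      by (rule reg(4)) (use that R pos n in \<open>auto simp: of_nat_diff\<close>)
    then show ?thesis by (simp add: in_class_def)
  qed
  then show "s \<in> ?S" using pos unfolding s flip_sites_def by blast
next
  let ?g = "int p"
  have g: "2 * ?g + 1 \<le> int n" using n by simp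
  note reg = base_height_regions[OF g]
  fix s assume S: "s \<in> ?S"
  then obtain a b where s: "s = (Suc a, Suc b)"
    unfolding flip_sites_def by (auto elim!: less_natE simp: gr0_conv_Suc)
  then have pos: "Suc a < n" "Suc b < n"
    and nc: "\<not> in_class ?g (base_height n ?g (Suc a) (Suc b))" "\<not> in_class ?g (base_height n ?g a (Suc b))"
      "\<not> in_class ?g (base_height n ?g (Suc (Suc a)) (Suc b))" "\<not> in_class ?g (base_height n ?g (Suc a) b)"
      "\<not> in_class ?g (base_height n ?g (Suc a) (Suc (Suc b)))"
    using S unfolding flip_sites_def by auto
  have three: "in_class ?g h \<or> in_class ?g (h + 1) \<or> in_class ?g (h - 1)" for h
    unfolding in_class_def by presburger
  have no: "\<not> in_class ?g (?g + 1)" "\<not> in_class ?g (?g + 2)" "\<not> in_class ?g (1 + ?g)"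
    "\<not> in_class ?g (2 + ?g)" by (simp_all add: in_class_def)
  have 1: "p + 2 \<le> Suc a + Suc b"
  proof (rule ccontr)
    assume *: "\<not> p + 2 \<le> Suc a + Suc b"
    define v where "v = int a + int b + 2"
    have v: "v \<le> ?g + 1" using * n by (simp add: v_def)
    have "base_height n ?g (Suc a) b = v - 1"
      using reg(1)[of "Suc a" b] pos v by (simp add: v_def)
    then have "\<not> in_class ?g (v - 1)" using nc by metis
    moreover have "\<not> in_class ?g v"
    proof (cases "v = ?g + 1")
      case False
      then have "base_height n ?g (Suc a) (Suc b) = v"
        using reg(1)[of "Suc a" "Suc b"] pos v by (simp add: v_def)
      then show ?thesis using nc by metis
    qed (use no in simp)
    moreover have "\<not> in_class ?g (v + 1)"
    proof -
      consider "v = ?g + 1" | "v = ?g" | "v < ?g" using v by linarith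
      then show ?thesis
      proof cases
        case 3
        then have "base_height n ?g (Suc a) (Suc (Suc b)) = v + 1"
          using reg(1)[of "Suc a" "Suc (Suc b)"] pos by (simp add: v_def)
        then show ?thesis using nc by metis
      qed (use no in \<open>simp_all\<close>)
    qed
    ultimately show False using three[of v] by blast
  qed
  have 2: "Suc a + Suc b \<le> 3 * p"
  proof (rule ccontr)
    assume *: "\<not> Suc a + Suc b \<le> 3 * p"
    define v where "v = 2 * int n - int a - int b - 2"
    have v: "v \<le> ?g + 1" using * n by (simp add: v_def)
    have "base_height n ?g (Suc a) (Suc (Suc b)) = v - 1"
      using reg(2)[of "Suc a" "Suc (Suc b)"] pos v by (simp add: v_def)
    then have "\<not> in_class ?g (v - 1)" using nc by metis
    moreover have "\<not> in_class ?g v"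
    proof (cases "v = ?g + 1")
      case False
      then have "base_height n ?g (Suc a) (Suc b) = v"
        using reg(2)[of "Suc a" "Suc b"] pos v by (simp add: v_def)
      then show ?thesis using nc by metis
    qed (use no in simp)
    moreover have "\<not> in_class ?g (v + 1)"
    proof -
      consider "v = ?g + 1" | "v = ?g" | "v < ?g" using v by linarith
      then show ?thesis
      proof cases
        case 3
        then have "base_height n ?g (Suc a) b = v + 1"
          using reg(2)[of "Suc a" b] pos by (simp add: v_def)
        then show ?thesis using nc by metis
      qed (use no in \<open>simp_all\<close>)
    qed
    ultimately show False using three[of v] by blast
  qed
  have 3: "Suc b \<le> Suc a + p + 1"
  proof (rule ccontr)
    assume *: "\<not> Suc b \<le> Suc a + p + 1"
    define v where "v = int b - int a"
    have v: "?g + 2 \<le> v" using * n by (simp add: v_def)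
    have "base_height n ?g (Suc a) (Suc (Suc b)) = v + 1"
      using reg(3)[of "Suc a" "Suc (Suc b)"] pos v by (simp add: v_def)
    then have "\<not> in_class ?g (v + 1)" using nc by metis
    moreover have "\<not> in_class ?g v"
    proof (cases "v = ?g + 2")
      case False
      then have "base_height n ?g (Suc a) (Suc b) = v"
        using reg(3)[of "Suc a" "Suc b"] pos v by (simp add: v_def)
      then show ?thesis using nc by metis
    qed (use no in simp)
    moreover have "\<not> in_class ?g (v - 1)"
    proof -
      consider "v = ?g + 2" | "v = ?g + 3" | "v > ?g + 3" using v by linarith
      then show ?thesis
      proof cases
        case 3
        then have "base_height n ?g (Suc a) b = v - 1"
          using reg(3)[of "Suc a" b] pos by (simp add: v_def)
        then show ?thesis using nc by metis
      qed (use no in \<open>simp_all\<close>)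
    qed
    ultimately show False using three[of v] by blast
  qed
  have 4: "Suc a \<le> Suc b + p + 1"
  proof (rule ccontr)
    assume *: "\<not> Suc a \<le> Suc b + p + 1"
    define v where "v = int a - int b"
    have v: "?g + 2 \<le> v" using * n by (simp add: v_def)
    have "base_height n ?g (Suc (Suc a)) (Suc b) = v + 1"
      using reg(3)[of "Suc (Suc a)" "Suc b"] pos v by (simp add: v_def)
    then have "\<not> in_class ?g (v + 1)" using nc by metis
    moreover have "\<not> in_class ?g v"
    proof (cases "v = ?g + 2")
      case False
      then have "base_height n ?g (Suc a) (Suc b) = v"
        using reg(3)[of "Suc a" "Suc b"] pos v by (simp add: v_def)
      then show ?thesis using nc by metis
    qed (use no in simp)
    moreover have "\<not> in_class ?g (v - 1)"
    proof -
      consider "v = ?g + 2" | "v = ?g + 3" | "v > ?g + 3" using v by linarith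
      then show ?thesis
      proof cases
        case 3
        then have "base_height n ?g a (Suc b) = v - 1"
          using reg(3)[of a "Suc b"] pos by (simp add: v_def)
        then show ?thesis using nc by metis
      qed (use no in \<open>simp_all\<close>)
    qed
    ultimately show False using three[of v] by blast
  qed
  show "s \<in> ?R" using 1 2 3 4 s by simp
qed

text \<open>The sites form a tilted rectangle, which splits by the parity of \<open>i + j\<close> into two tilted grids.\<close>

lemma card_flip_sites_odd:
  assumes n: "n = 2 * p + 1"
  shows "card (flip_sites n (int p)) + (if p = 0 then 0 else 2) = 2 * p * (p + 1)"
proof (cases "p = 0")
  case True
  then have "flip_sites n (int p) = {}" unfolding flip_sites_odd[OF n] by auto
  with True show ?thesis by simp
next
  case False
  let ?f = "\<lambda>(a, b). (p + 2 + b - a, 1 + a + b)" and ?h = "\<lambda>(a, b). (p + 1 + b - a, 1 + a + b)"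
  let ?X = "?f ` ({..p + 1} \<times> {..<p - 1})" and ?Y = "?h ` ({..p} \<times> {..<p})"
  have "flip_sites n (int p) = ?X \<union> ?Y"
    unfolding flip_sites_odd[OF n]
  proof (intro equalityI subsetI)
    fix s assume "s \<in> {(i, j). i \<le> j + p + 1 \<and> j \<le> i + p + 1 \<and> p + 2 \<le> i + j \<and> i + j \<le> 3 * p}"
    then obtain i j where s: "s = (i, j)" and
      R: "i \<le> j + p + 1" "j \<le> i + p + 1" "p + 2 \<le> i + j" "i + j \<le> 3 * p" by auto
    show "s \<in> ?X \<union> ?Y"
    proof (cases "even (i + j + p)")
      case True
      then have "even (i + j - (p + 2))" using R by simp
      then obtain b where "i + j - (p + 2) = 2 * b" by (elim dvdE)
      then have b: "i + j = p + 2 + 2 * b" using R by simp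
      define a where "a = j - (1 + b)"
      have "j = 1 + a + b" using b R unfolding a_def by linarith
      moreover from this have "i + a = p + 1 + b" using b by linarith
      moreover from calculation have "a \<le> p" "b < p" using R b False by linarith+
      ultimately have "s = ?h (a, b)" "(a, b) \<in> {..p} \<times> {..<p}" using s by auto
      then show ?thesis by blast
    next
      case odd: False
      then have "odd (i + j - (p + 2))" using R by simp
      then obtain b where "i + j - (p + 2) = 2 * b + 1" by (elim oddE)
      then have b: "i + j = p + 3 + 2 * b" using R by simp
      define a where "a = j - (1 + b)"
      have "j = 1 + a + b" using b R unfolding a_def by linarith
      moreover from this have "i + a = p + 2 + b" using b by linarith
      moreover from calculation have "a \<le> p + 1" "b < p - 1" using R b by linarith+
      ultimately have "s = ?f (a, b)" "(a, b) \<in> {..p + 1} \<times> {..<p - 1}" using s by auto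
      then show ?thesis by blast
    qed
  qed auto
  moreover have "?X \<inter> ?Y = {}"
  proof -
    have "odd (fst s + snd s + p)" if "s \<in> ?X" for s using that by auto
    moreover have "even (fst s + snd s + p)" if "s \<in> ?Y" for s using that by auto
    ultimately show ?thesis by blast
  qed
  moreover have "card ?X = (p + 2) * (p - 1)"
    by (subst card_image) (auto simp: inj_on_def)
  moreover have "card ?Y = (p + 1) * p"
    by (subst card_image) (auto simp: inj_on_def)
  ultimately have "card (flip_sites n (int p)) = (p + 2) * (p - 1) + (p + 1) * p"
    by (simp add: card_Un_disjoint)
  moreover obtain m where "p = Suc m" using False by (cases p) auto
  ultimately show ?thesis by (simp add: algebra_simps)
qed

subsection \<open>The minimal number of squares of a colour\<close>

lemma sum_symmetric_odd:
  fixes f :: "nat \<Rightarrow> int"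
  assumes "\<And>s. s \<le> p \<Longrightarrow> f (p - s) = F s" "\<And>s. s \<le> p \<Longrightarrow> f (p + 1 + s) = F s"
  shows "(\<Sum>i\<le>2 * p + 1. f i) = 2 * (\<Sum>s\<le>p. F s)"
proof -
  have "{..2 * p + 1} = (\<lambda>s. p - s) ` {..p} \<union> (\<lambda>s. p + 1 + s) ` {..p}"
  proof (intro equalityI subsetI)
    fix i assume "i \<in> {..2 * p + 1}"
    then have "i = p - (p - i) \<or> (i = p + 1 + (i - (p + 1)) \<and> i - (p + 1) \<le> p)" by auto
    then show "i \<in> (\<lambda>s. p - s) ` {..p} \<union> (\<lambda>s. p + 1 + s) ` {..p}"
      by (metis Un_iff atMost_iff diff_le_self image_eqI)
  qed auto
  moreover have "(\<lambda>s. p - s) ` {..p} \<inter> (\<lambda>s. p + 1 + s) ` {..p} = {}" by auto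
  ultimately have "(\<Sum>i\<le>2 * p + 1. f i) = (\<Sum>i\<in>(\<lambda>s. p - s) ` {..p}. f i) + (\<Sum>i\<in>(\<lambda>s. p + 1 + s) ` {..p}. f i)"
    by (simp only: sum.union_disjoint finite_imageI finite_atMost)
  also have "\<dots> = (\<Sum>s\<le>p. f (p - s)) + (\<Sum>s\<le>p. f (p + 1 + s))"
    by (subst (1 2) sum.reindex) (auto simp: inj_on_def)
  also have "\<dots> = (\<Sum>s\<le>p. F s) + (\<Sum>s\<le>p. F s)"
    using assms by (intro arg_cong2[of _ _ _ _ "(+)"] sum.cong) auto
  finally show ?thesis by simp
qed

lemma sum_symmetric_even:
  fixes f :: "nat \<Rightarrow> int"
  assumes "\<And>s. s \<le> p \<Longrightarrow> f (p - s) = F s" "\<And>s. s \<le> p \<Longrightarrow> f (p + s) = F s"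
  shows "(\<Sum>i\<le>2 * p. f i) = 2 * (\<Sum>s\<le>p. F s) - F 0"
proof -
  \<comment> \<open>Repeating the middle row gives an even number of rows, to which the previous
    pairing applies.\<close>
  have "(\<Sum>i\<le>2 * p + 1. if i \<le> p then f i else f (i - 1)) = 2 * (\<Sum>s\<le>p. F s)"
    using assms by (intro sum_symmetric_odd) auto
  moreover have "(\<Sum>i\<le>p + k. f i) = (\<Sum>i\<le>p + k + 1. if i \<le> p then f i else f (i - 1)) - f p" for k
    by (induction k) auto
  from this[of p] have "(\<Sum>i\<le>2 * p. f i)
      = (\<Sum>i\<le>2 * p + 1. if i \<le> p then f i else f (i - 1)) - f p"
    by (simp only: mult_2)
  ultimately show ?thesis using assms(1)[of 0] by simp
qed

text \<open>Three times the level is \<open>2 * (h - \<gamma>)\<close> up to a correction in -1, 0,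
  1 depending on the residue; the factor 3 avoids integer division in the sums that follow.\<close>

lemma three_row_min:
  assumes "2 * i \<le> n"
  shows "3 * row_min n \<gamma> i = 2 * (int n - 2 * int i)
    + (if (int n - int i - \<gamma>) mod 3 = 0 then 3 else if (int n - int i - \<gamma>) mod 3 = 1 then 1 else -1)
    + (if (int i - \<gamma>) mod 3 = 0 then 3 else if (int i - \<gamma>) mod 3 = 1 then -1 else 1)"
proof -
  have level: "3 * level \<gamma> h = 2 * h - 2 * \<gamma> + (if (h - \<gamma>) mod 3 = 0 then 0 else if (h - \<gamma>) mod 3 = 1 then 1 else -1)" for h
  proof -
    define d m where "d = (h - \<gamma>) div 3" and "m = (h - \<gamma>) mod 3"
    have "h - \<gamma> = 3 * d + m" by (simp add: d_def m_def)
    moreover have "m = 0 \<or> m = 1 \<or> m = 2" unfolding m_def by presburger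
    ultimately show ?thesis unfolding level_def d_def[symmetric] m_def[symmetric] by auto
  qed
  have "3 * row_min n \<gamma> i = 3 * of_bool (in_class \<gamma> (int i)) + 3 * of_bool (in_class \<gamma> (int n - int i))
     + (3 * level \<gamma> (int n - int i) - 3 * level \<gamma> (int i))"
    using assms by (simp add: row_min_def row_sign_def algebra_simps)
  then show ?thesis unfolding level in_class_def by (simp add: of_bool_def)
qed

lemma row_min_symmetric:
  "i \<le> n \<Longrightarrow> 2 * i \<noteq> n \<Longrightarrow> row_min n \<gamma> (n - i) = row_min n \<gamma> i"
  by (auto simp: row_min_def row_sign_def of_nat_diff algebra_simps)

lemma nat_mod_3_cases:
  fixes s :: nat
  obtains t where "s = 3 * t" | t where "s = 3 * t + 1" | t where "s = 3 * t + 2"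
proof -
  have "s = 3 * (s div 3) \<or> s = 3 * (s div 3) + 1 \<or> s = 3 * (s div 3) + 2" by presburger
  then show thesis using that by blast
qed

text \<open>With \<open>s\<close> the distance from the middle, the corrections 6, 2, 4 have period
  3 and mean 4. Summation gives a quadratic polynomial and a periodic remainder.\<close>

lemma sum_row_min_odd:
  assumes n: "n = 2 * p + 1"
  shows "3 * (\<Sum>i\<le>n. row_min n (int p) i) = 4 * int ((p + 1) * (p + 2)) + (if p mod 3 = 0 then 4 else 0)"
proof -
  define F where "F s = row_min n (int p) (p - s)" for s
  have F: "3 * F s = 4 * int s + (if s mod 3 = 0 then 6 else if s mod 3 = 1 then 2 else 4)" if "s \<le> p" for s
  proof -
    have i: "int n - int (p - s) - int p = int s + 1" "int (p - s) - int p = - int s" "2 * (p - s) \<le> n"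
      "int n - 2 * int (p - s) = 2 * int s + 1"
      using that n by auto
    show ?thesis unfolding F_def three_row_min[OF i(3)] i
      by (cases s rule: nat_mod_3_cases) (simp; presburger)+
  qed
  have "row_min n (int p) (p + 1 + s) = F s" if "s \<le> p" for s
    using that n row_min_symmetric[of "p - s" n "int p"] by (simp add: F_def)
  then have "(\<Sum>i\<le>n. row_min n (int p) i) = 2 * (\<Sum>s\<le>p. F s)"
    unfolding n by (intro sum_symmetric_odd) (auto simp: F_def n)
  moreover have "3 * (\<Sum>s\<le>q. F s) = 2 * int ((q + 1) * (q + 2)) + (if q mod 3 = 0 then 2 else 0)" if "q \<le> p" for q
    using that
  proof (induction q)
    case (Suc q)
    have "q mod 3 = 0 \<and> Suc q mod 3 = 1 \<or> q mod 3 = 1 \<and> Suc q mod 3 = 2 \<or> q mod 3 = 2 \<and> Suc q mod 3 = 0"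
      by presburger
    then show ?case using F[of "Suc q"] Suc by (auto simp: algebra_simps)
  qed (use F[of 0] in simp)
  from this[of p] have "3 * (\<Sum>s\<le>p. F s) = 2 * int ((p + 1) * (p + 2)) + (if p mod 3 = 0 then 2 else 0)" by simp
  ultimately show ?thesis by (auto split: if_splits)
qed

lemma sum_row_min_even:
  assumes n: "n = 2 * p"
  shows "3 * (\<Sum>i\<le>n. row_min n (int p - 1) i) = 4 * int (p * (p + 2)) + (if p mod 3 = 2 then 4 else 0)"
proof -
  define F where "F s = row_min n (int p - 1) (p - s)" for s
  have F: "3 * F s = 4 * int s + (if s mod 3 = 0 then 0 else if s mod 3 = 1 then 2 else 4)" if "s \<le> p" for s
  proof -
    have i: "int n - int (p - s) - (int p - 1) = int s + 1" "int (p - s) - (int p - 1) = 1 - int s" "2 * (p - s) \<le> n"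
      "int n - 2 * int (p - s) = 2 * int s"
      using that n by auto
    show ?thesis unfolding F_def three_row_min[OF i(3)] i
      by (cases s rule: nat_mod_3_cases) (simp; presburger)+
  qed
  have "row_min n (int p - 1) (p + s) = F s" if "s \<le> p" for s
    using that n row_min_symmetric[of "p - s" n "int p - 1"] by (cases "s = 0") (simp_all add: F_def)
  then have "(\<Sum>i\<le>n. row_min n (int p - 1) i) = 2 * (\<Sum>s\<le>p. F s) - F 0"
    unfolding n by (intro sum_symmetric_even) (auto simp: F_def n)
  moreover have "3 * (\<Sum>s\<le>q. F s) = 2 * int (q * (q + 2)) + (if q mod 3 = 2 then 2 else 0)" if "q \<le> p" for q
    using that
  proof (induction q)
    case (Suc q)
    have "q mod 3 = 0 \<and> Suc q mod 3 = 1 \<or> q mod 3 = 1 \<and> Suc q mod 3 = 2 \<or> q mod 3 = 2 \<and> Suc q mod 3 = 0"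
      by presburger
    then show ?case using F[of "Suc q"] Suc by (auto simp: algebra_simps)
  qed (use F[of 0] in simp)
  from this[of p] have "3 * (\<Sum>s\<le>p. F s) = 2 * int (p * (p + 2)) + (if p mod 3 = 2 then 2 else 0)" by simp
  moreover have "F 0 = 0" using F[of 0] by simp
  ultimately show ?thesis by (auto split: if_splits)
qed

lemma sum_row_min_middle:
  assumes n: "n = 2 * p"
  shows "3 * (\<Sum>i\<le>n. row_min n (int p) i) = 4 * int (p * (p + 2)) + (if p mod 3 = 2 then -2 else 6)"
proof -
  define F where "F s = row_min n (int p) (p - s)" for s
  have F: "3 * F s = 4 * int s + (if s mod 3 = 0 then 6 else if s mod 3 = 1 then 2 else -2)" if "s \<le> p" for s
  proof -
    have i: "int n - int (p - s) - int p = int s" "int (p - s) - int p = - int s" "2 * (p - s) \<le> n"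
      "int n - 2 * int (p - s) = 2 * int s"
      using that n by auto
    show ?thesis unfolding F_def three_row_min[OF i(3)] i
      by (cases s rule: nat_mod_3_cases) (simp; presburger)+
  qed
  have "row_min n (int p) (p + s) = F s" if "s \<le> p" for s
    using that n row_min_symmetric[of "p - s" n "int p"] by (cases "s = 0") (simp_all add: F_def)
  then have "(\<Sum>i\<le>n. row_min n (int p) i) = 2 * (\<Sum>s\<le>p. F s) - F 0"
    unfolding n by (intro sum_symmetric_even) (auto simp: F_def n)
  moreover have "3 * (\<Sum>s\<le>q. F s) = 2 * int (q * (q + 2)) + (if q mod 3 = 2 then 2 else 6)" if "q \<le> p" for q
    using that
  proof (induction q)
    case (Suc q)
    have "q mod 3 = 0 \<and> Suc q mod 3 = 1 \<or> q mod 3 = 1 \<and> Suc q mod 3 = 2 \<or> q mod 3 = 2 \<and> Suc q mod 3 = 0"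
      by presburger
    then show ?case using F[of "Suc q"] Suc by (auto simp: algebra_simps)
  qed (use F[of 0] in simp)
  from this[of p] have "3 * (\<Sum>s\<le>p. F s) = 2 * int (p * (p + 2)) + (if p mod 3 = 2 then 2 else 6)" by simp
  moreover have "F 0 = 2" using F[of 0] by simp
  ultimately show ?thesis by (auto split: if_splits)
qed

text \<open>The middle row starts and ends at height \<open>p\<close>, so its level would have to be
  constant; but it must leave the class on its first step. In terms of counting, its formal minimum
  is one visit, while its two end squares are already two.\<close>

lemma middle_class_bad_step:
  assumes n: "n = 2 * p" "0 < p" and H: "height_fun n H"
  shows "bad_steps n (int p) H \<noteq> {}"
proof
  assume bad: "bad_steps n (int p) H = {}"
  have p: "p \<le> n" "0 < n" "row_sign n p = 1" using n by (auto simp: row_sign_def)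
  have H0: "H p 0 = int p" "H p n = int p" using height_funD(4,6)[OF H p(1)] n by simp_all
  then have "H p 1 = int p + 1"
    using good_step_from_class(1)[OF H, of p 0 "int p"] bad p by (simp add: in_class_def)
  then have "level (int p) (H p 1) = 1" by (simp add: level_eq_1_iff)
  then show False using level_mono_in_row[of n p "int p" H 1 n] bad p H0 by simp
qed

subsection \<open>Chessboards and height functions\<close>

lemma chessboardD:
  assumes "c \<in> chessboards n"
  shows "i \<le> n \<Longrightarrow> j \<le> n \<Longrightarrow> c (Suc i, Suc j) \<le> 2"
    "i \<le> n \<Longrightarrow> j < n \<Longrightarrow> c (Suc i, Suc j) \<noteq> c (Suc i, Suc (Suc j))"
    "i < n \<Longrightarrow> j \<le> n \<Longrightarrow> c (Suc i, Suc j) \<noteq> c (Suc (Suc i), Suc j)"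
    "k \<le> n \<Longrightarrow> c (1, Suc k) = k mod 3" "k \<le> n \<Longrightarrow> c (Suc k, 1) = k mod 3"
    "k \<le> n \<Longrightarrow> c (Suc n, Suc k) = (n - k) mod 3" "k \<le> n \<Longrightarrow> c (Suc k, Suc n) = (n - k) mod 3"
proof -
  have PiE: "c \<in> squares n \<rightarrow>\<^sub>E {0, 1, 2}"
    and hor: "\<forall>i\<in>{1..n+1}. \<forall>j\<in>{1..n}. c (i, j) \<noteq> c (i, j+1)"
    and ver: "\<forall>i\<in>{1..n}. \<forall>j\<in>{1..n+1}. c (i, j) \<noteq> c (i+1, j)"
    and bd: "\<forall>i\<in>{1..n+1}. c (1, i) = (i - 1) mod 3 \<and> c (i, 1) = (i - 1) mod 3 \<and>
        c (n+1, n+2-i) = (i - 1) mod 3 \<and> c (n+2-i, n+1) = (i - 1) mod 3"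
    using assms unfolding chessboards_def by blast+
  show "i \<le> n \<Longrightarrow> j \<le> n \<Longrightarrow> c (Suc i, Suc j) \<le> 2"
    using PiE_mem[OF PiE, of "(Suc i, Suc j)"] by (auto simp: squares_def)
  show "i \<le> n \<Longrightarrow> j < n \<Longrightarrow> c (Suc i, Suc j) \<noteq> c (Suc i, Suc (Suc j))"
    using hor[rule_format, of "Suc i" "Suc j"] by simp
  show "i < n \<Longrightarrow> j \<le> n \<Longrightarrow> c (Suc i, Suc j) \<noteq> c (Suc (Suc i), Suc j)"
    using ver[rule_format, of "Suc i" "Suc j"] by simp
  assume k: "k \<le> n"
  show "c (1, Suc k) = k mod 3" "c (Suc k, 1) = k mod 3"
    using bd[rule_format, of "Suc k"] k by simp_all
  show "c (Suc n, Suc k) = (n - k) mod 3" "c (Suc k, Suc n) = (n - k) mod 3"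
    using bd[rule_format, of "Suc (n - k)"] k by (simp_all add: Suc_diff_le)
qed

text \<open>Heights are summed along rows from the left border, reading a colour change as a step of
  1 or -1. That vertical steps are units too is the absence of monodromy around a cell of four
  squares.\<close>

lemma chessboard_height:
  assumes c: "c \<in> chessboards n"
  obtains H where "height_fun n H"
    "\<And>i j. i \<le> n \<Longrightarrow> j \<le> n \<Longrightarrow> int (c (Suc i, Suc j)) = H i j mod 3"
proof -
  note cD = chessboardD[OF c]
  define step :: "nat \<Rightarrow> nat \<Rightarrow> int" where "step a b = (if b = (a + 1) mod 3 then 1 else -1)" for a b
  define H where "H i j = int i + (\<Sum>l<j. step (c (Suc i, Suc l)) (c (Suc i, Suc (Suc l))))" for i j
  have step: "int b = (int a + step a b) mod 3" if "a \<le> 2" "b \<le> 2" "a \<noteq> b" for a b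
  proof -
    have "a = 0 \<or> a = 1 \<or> a = 2" "b = 0 \<or> b = 1 \<or> b = 2" using that by auto
    then show ?thesis using that by (elim disjE) (simp_all add: step_def)
  qed
  have H_Suc: "H i (Suc j) = H i j + step (c (Suc i, Suc j)) (c (Suc i, Suc (Suc j)))" for i j
    by (simp add: H_def)
  have H0: "H i 0 = int i" for i by (simp add: H_def)
  have col: "int (c (Suc i, Suc j)) = H i j mod 3" if "i \<le> n" "j \<le> n" for i j
    using that(2)
  proof (induction j)
    case 0
    then show ?case using cD(5)[of i] that by (simp add: H0 zmod_int)
  next
    case (Suc j)
    then show ?case
      using step[of "c (Suc i, Suc j)" "c (Suc i, Suc (Suc j))"] cD(1)[of i j] cD(1)[of i "Suc j"] cD(2)[of i j] that
      by (simp add: H_Suc mod_simps)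
  qed
  have hor: "H i (Suc j) = H i j + 1 \<or> H i (Suc j) = H i j - 1" for i j
    by (auto simp: H_Suc step_def)
  have ver: "H (Suc i) j - H i j = 1 \<or> H (Suc i) j - H i j = -1" if "i < n" "j \<le> n" for i j
    using that(2)
  proof (induction j)
    case (Suc j)
    then have "H (Suc i) j - H i j = 1 \<or> H (Suc i) j - H i j = -1" by simp
    \<comment> \<open>Two parallel unit steps change the difference by 0 or 2 in absolute value. A
      difference of 3 or -3 would give vertically adjacent squares the same colour.\<close>
    then have "H (Suc i) (Suc j) - H i (Suc j) = 1 \<or> H (Suc i) (Suc j) - H i (Suc j) = -1 \<or>
        H (Suc i) (Suc j) = H i (Suc j) + 3 \<or> H (Suc i) (Suc j) = H i (Suc j) - 3"
      using hor[of i j] hor[of "Suc i" j] by linarith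
    moreover have "H (Suc i) (Suc j) mod 3 \<noteq> H i (Suc j) mod 3"
      using cD(3)[of i "Suc j"] col[of i "Suc j"] col[of "Suc i" "Suc j"] that Suc by simp
    ultimately show ?case by (metis mod_add_self2 minus_mod_self2)
  qed (simp add: H0)
  have top: "H 0 k = int k" if "k \<le> n" for k
    using that
  proof (induction k)
    case (Suc k)
    then show ?case using cD(4)[of k] cD(4)[of "Suc k"] by (simp add: H_Suc step_def mod_simps)
  qed (simp add: H0)
  have down: "x = y - 1" if "x = y + 1 \<or> x = y - 1" "int a = y mod 3" "int b = x mod 3"
    "a = Suc m mod 3" "b = m mod 3" for x y :: int and a b m :: nat
  proof -
    have "int (Suc m) mod 3 = y mod 3" "int m mod 3 = x mod 3" using that by (simp_all add: zmod_int)
    then show ?thesis using that(1) by presburger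
  qed
  have bottom: "H n k = int n - int k" if "k \<le> n" for k
    using that
  proof (induction k)
    case (Suc k)
    then have "H n (Suc k) = H n k - 1"
      using down[OF hor, of _ n k _ "n - Suc k"] cD(6)[of k] cD(6)[of "Suc k"] col[of n k] col[of n "Suc k"]
      by (simp add: Suc_diff_Suc)
    then show ?case using Suc by simp
  qed (simp add: H0)
  have right: "H k n = int n - int k" if "k \<le> n" for k
    using that
  proof (induction k)
    case (Suc k)
    then have "H (Suc k) n = H k n + 1 \<or> H (Suc k) n = H k n - 1" using ver[of k n] by force
    then have "H (Suc k) n = H k n - 1"
      using down[of "H (Suc k) n" "H k n" _ _ "n - Suc k"] cD(7)[of k] cD(7)[of "Suc k"] col[of k n] col[of "Suc k" n] Suc
      by (simp add: Suc_diff_Suc)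
    then show ?case using Suc by simp
  qed (simp add: top)
  have "\<bar>H i (Suc j) - H i j\<bar> = 1" for i j using hor[of i j] by linarith
  moreover have "\<bar>H (Suc i) j - H i j\<bar> = 1" if "i < n" "j \<le> n" for i j using ver[OF that] by linarith
  ultimately have "height_fun n H"
    unfolding height_fun_def using top H0 bottom right by simp
  then show thesis using col by (rule that)
qed

definition board_of :: "nat \<Rightarrow> (nat \<Rightarrow> nat \<Rightarrow> int) \<Rightarrow> nat \<times> nat \<Rightarrow> nat" where
  "board_of n H = (\<lambda>(a, b)\<in>squares n. nat (H (a - 1) (b - 1) mod 3))"

lemma board_of_Suc: "i \<le> n \<Longrightarrow> j \<le> n \<Longrightarrow> board_of n H (Suc i, Suc j) = nat (H i j mod 3)"
  by (simp add: board_of_def squares_def)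

lemma ball_Suc_atLeastAtMost:
  "(\<forall>i\<in>{1..m+1}. P i) \<longleftrightarrow> (\<forall>i\<le>m. P (Suc i))" "(\<forall>i\<in>{1..m}. P i) \<longleftrightarrow> (\<forall>i<m. P (Suc i))"
proof -
  have "{1..m+1} = Suc ` {..m}" "{1..m} = Suc ` {..<m}"
    by (simp_all only: image_Suc_atMost image_Suc_lessThan Suc_eq_plus1)
  then show "(\<forall>i\<in>{1..m+1}. P i) \<longleftrightarrow> (\<forall>i\<le>m. P (Suc i))" "(\<forall>i\<in>{1..m}. P i) \<longleftrightarrow> (\<forall>i<m. P (Suc i))"
    by auto
qed

lemma board_of_chessboard:
  assumes H: "height_fun n H"
  shows "board_of n H \<in> chessboards n"
proof -
  have "board_of n H \<in> squares n \<rightarrow>\<^sub>E {0, 1, 2}"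
  proof -
    have "nat (h mod 3) \<in> {0, 1, 2}" for h :: int
    proof -
      have "h mod 3 = 0 \<or> h mod 3 = 1 \<or> h mod 3 = 2" by presburger
      then show ?thesis by auto
    qed
    then have "(\<lambda>(a, b). nat (H (a - 1) (b - 1) mod 3)) \<in> squares n \<rightarrow> {0, 1, 2}"
      by (simp only: Pi_iff split_beta) blast
    then show ?thesis unfolding board_of_def by (simp only: restrict_PiE)
  qed
  moreover have ne: "nat (a mod 3) \<noteq> nat (b mod 3)" if "a = b + 1 \<or> a = b - 1" for a b :: int
  proof -
    have "(b + 1) mod 3 \<noteq> b mod 3" "(b - 1) mod 3 \<noteq> b mod 3" by presburger+
    then have "a mod 3 \<noteq> b mod 3" using that by metis
    then show ?thesis by (metis nat_0_le pos_mod_sign zero_less_numeral)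
  qed
  have "\<forall>i\<in>{1..n+1}. \<forall>j\<in>{1..n}. board_of n H (i, j) \<noteq> board_of n H (i, j+1)"
    unfolding ball_Suc_atLeastAtMost(1) unfolding ball_Suc_atLeastAtMost(2)
    using ne[OF height_funD(1)[OF H]] by (simp add: board_of_Suc) metis
  moreover have "\<forall>i\<in>{1..n}. \<forall>j\<in>{1..n+1}. board_of n H (i, j) \<noteq> board_of n H (i+1, j)"
    unfolding ball_Suc_atLeastAtMost(1) unfolding ball_Suc_atLeastAtMost(2)
    using ne[OF height_funD(2)[OF H]] by (simp add: board_of_Suc) metis
  moreover have "\<forall>i\<in>{1..n+1}. board_of n H (1, i) = (i - 1) mod 3 \<and> board_of n H (i, 1) = (i - 1) mod 3 \<and>
        board_of n H (n+1, n+2-i) = (i - 1) mod 3 \<and> board_of n H (n+2-i, n+1) = (i - 1) mod 3"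
  proof
    fix i assume "i \<in> {1..n+1}"
    then obtain k where k: "i = Suc k" "k \<le> n" by (cases i) auto
    have m: "nat (int k mod 3) = k mod 3" by (simp add: nat_mod_as_int)
    have e: "n + 2 - i = Suc (n - k)" "int n - int (n - k) = int k" using k by auto
    show "board_of n H (1, i) = (i - 1) mod 3 \<and> board_of n H (i, 1) = (i - 1) mod 3 \<and>
        board_of n H (n+1, n+2-i) = (i - 1) mod 3 \<and> board_of n H (n+2-i, n+1) = (i - 1) mod 3"
      using height_funD(3,4)[OF H k(2)] height_funD(5,6)[OF H, of "n - k"] m e
        board_of_Suc[OF le0 k(2), of H] board_of_Suc[OF k(2) le0, of H] board_of_Suc[of n n "n - k" H] board_of_Suc[of "n - k" n n H]
      by (simp add: k(1))
  qed
  ultimately show ?thesis unfolding chessboards_def by blast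
qed

lemma finite_chessboards: "finite (chessboards n)"
  by (rule finite_subset[of _ "squares n \<rightarrow>\<^sub>E {0, 1, 2}"])
    (auto simp: chessboards_def squares_def intro!: finite_PiE)

section \<open>Boards by their number of squares of one colour\<close>

definition colour_count :: "nat \<Rightarrow> nat \<Rightarrow> (nat \<times> nat \<Rightarrow> nat) \<Rightarrow> nat" where
  "colour_count n k c = card {s \<in> squares n. c s = k}"

lemma colour_count_eq:
  assumes "\<And>i j. i \<le> n \<Longrightarrow> j \<le> n \<Longrightarrow> int (c (Suc i, Suc j)) = H i j mod 3"
  shows "colour_count n (nat (\<gamma> mod 3)) c = card (class_squares n \<gamma> H)"
proof -
  have iff: "c (Suc i, Suc j) = nat (\<gamma> mod 3) \<longleftrightarrow> in_class \<gamma> (H i j)" if "i \<le> n" "j \<le> n" for i j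
  proof -
    have "c (Suc i, Suc j) = nat (\<gamma> mod 3) \<longleftrightarrow> H i j mod 3 = \<gamma> mod 3"
      using assms[OF that] by (simp add: eq_nat_nat_iff flip: assms[OF that]) (metis nat_int int_nat_eq pos_mod_sign zero_less_numeral)
    also have "\<dots> \<longleftrightarrow> in_class \<gamma> (H i j)" unfolding in_class_def by presburger
    finally show ?thesis .
  qed
  have "{s \<in> squares n. c s = nat (\<gamma> mod 3)} = (\<lambda>(i, j). (Suc i, Suc j)) ` class_squares n \<gamma> H"
  proof (intro equalityI subsetI)
    fix s assume s: "s \<in> {s \<in> squares n. c s = nat (\<gamma> mod 3)}"
    then obtain i j where "s = (Suc i, Suc j)" "i \<le> n" "j \<le> n"
      unfolding squares_def by (auto simp: Suc_le_D dest!: Suc_le_D)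
    then show "s \<in> (\<lambda>(i, j). (Suc i, Suc j)) ` class_squares n \<gamma> H"
      using s iff by (auto simp: class_squares_def)
  qed (use iff in \<open>auto simp: class_squares_def squares_def\<close>)
  then show ?thesis
    unfolding colour_count_def by (simp add: card_image inj_on_def split_def prod_eq_iff)
qed

lemma chessboard_eq_board_of:
  assumes "c \<in> chessboards n" "\<And>i j. i \<le> n \<Longrightarrow> j \<le> n \<Longrightarrow> int (c (Suc i, Suc j)) = H i j mod 3"
  shows "c = board_of n H"
proof
  fix s :: "nat \<times> nat"
  obtain a b where s: "s = (a, b)" by (cases s)
  show "c s = board_of n H s"
  proof (cases "s \<in> squares n")
    case True
    then obtain i j where "a = Suc i" "b = Suc j" "i \<le> n" "j \<le> n"
      unfolding s squares_def by (cases a; cases b) auto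
    then show ?thesis using assms(2)[of i j] by (simp add: s board_of_Suc flip: assms(2))
  next
    case False
    moreover have "c \<in> extensional (squares n)" using assms(1) by (simp add: chessboards_def PiE_def)
    ultimately have "c s = undefined" by (intro extensional_arb)
    with False show ?thesis by (simp add: board_of_def)
  qed
qed

lemma Z3C_one_colour:
  "Z3C n (\<lambda>i. if i = k then x else 1) = (\<Sum>c\<in>chessboards n. x ^ colour_count n k c)"
proof -
  have "(\<Prod>s\<in>squares n. if c s = k then x else 1) = x ^ colour_count n k c" for c
    unfolding colour_count_def
    by (subst prod.If_cases) (auto simp: squares_def Int_def)
  then show ?thesis by (simp add: Z3C_def)
qed

lemma Z3C_one_colour_poly:
  assumes "\<And>c. c \<in> chessboards n \<Longrightarrow> m \<le> colour_count n k c"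
  obtains P where "\<And>x. Z3C n (\<lambda>i. if i = k then x else 1) = x ^ m * poly P x"
    "coeff P 0 = of_nat (card {c \<in> chessboards n. colour_count n k c = m})"
    "coeff P 1 = of_nat (card {c \<in> chessboards n. colour_count n k c = Suc m})"
proof -
  define P :: "complex poly" where "P = (\<Sum>c\<in>chessboards n. monom 1 (colour_count n k c - m))"
  have "Z3C n (\<lambda>i. if i = k then x else 1) = x ^ m * poly P x" for x
    unfolding Z3C_one_colour P_def poly_sum poly_monom sum_distrib_left
    using assms by (intro sum.cong) (simp_all flip: power_add)
  moreover have "coeff P d = of_nat (card {c \<in> chessboards n. colour_count n k c = m + d})" for d
  proof -
    have "coeff P d = (\<Sum>c\<in>chessboards n. of_bool (colour_count n k c = m + d))"
      unfolding P_def coeff_sum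
    proof (rule sum.cong)
      fix c assume "c \<in> chessboards n"
      then show "coeff (monom 1 (colour_count n k c - m)) d = (of_bool (colour_count n k c = m + d) :: complex)"
        using assms[of c] by (auto simp: of_bool_def)
    qed simp
    then show ?thesis by (simp add: finite_chessboards Int_def)
  qed
  ultimately show thesis using that[of P] by simp
qed

lemma chessboard_bad_steps:
  assumes c: "c \<in> chessboards n" and m: "2 * int m = (\<Sum>i\<le>n. row_min n \<gamma> i)"
  obtains H where "height_fun n H"
    "\<And>i j. i \<le> n \<Longrightarrow> j \<le> n \<Longrightarrow> int (c (Suc i, Suc j)) = H i j mod 3"
    "colour_count n (nat (\<gamma> mod 3)) c = m + card (bad_steps n \<gamma> H)"
proof -
  obtain H where H: "height_fun n H"
    "\<And>i j. i \<le> n \<Longrightarrow> j \<le> n \<Longrightarrow> int (c (Suc i, Suc j)) = H i j mod 3"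
    using chessboard_height[OF c] by blast
  moreover have "colour_count n (nat (\<gamma> mod 3)) c = m + card (bad_steps n \<gamma> H)"
    using card_class_squares[OF H(1), of \<gamma>] colour_count_eq[of n c H \<gamma>] H(2) m by simp
  ultimately show thesis by (rule that)
qed

lemma colour_count_board_of:
  assumes H: "height_fun n H" and m: "2 * int m = (\<Sum>i\<le>n. row_min n \<gamma> i)"
  shows "colour_count n (nat (\<gamma> mod 3)) (board_of n H) = m + card (bad_steps n \<gamma> H)"
  using card_class_squares[OF H, of \<gamma>] colour_count_eq[of n "board_of n H" H \<gamma>] m
  by (simp add: board_of_Suc)

text \<open>A board attains \<open>m\<close> exactly if its height function has no bad steps, and
  only the base height has none.\<close>

lemma minimal_chessboard:
  assumes g: "2 * g + 1 \<le> int n" "int n \<le> 2 * g + 2" and m: "2 * int m = (\<Sum>i\<le>n. row_min n g i)"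
  shows "{c \<in> chessboards n. colour_count n (nat (g mod 3)) c = m} = {board_of n (base_height n g)}"
proof (intro equalityI subsetI)
  fix c assume "c \<in> {c \<in> chessboards n. colour_count n (nat (g mod 3)) c = m}"
  then have c: "c \<in> chessboards n" "colour_count n (nat (g mod 3)) c = m" by auto
  obtain H where H: "height_fun n H"
    "\<And>i j. i \<le> n \<Longrightarrow> j \<le> n \<Longrightarrow> int (c (Suc i, Suc j)) = H i j mod 3"
    "colour_count n (nat (g mod 3)) c = m + card (bad_steps n g H)"
    using chessboard_bad_steps[OF c(1) m] by blast
  then have "minimal_height n g H" using c by (simp add: minimal_height_def)
  then have "c = board_of n (base_height n g)"
    using H(2) minimal_height_unique[OF g] by (intro chessboard_eq_board_of[OF c(1)]) simp
  then show "c \<in> {board_of n (base_height n g)}" by simp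
next
  fix c assume "c \<in> {board_of n (base_height n g)}"
  then show "c \<in> {c \<in> chessboards n. colour_count n (nat (g mod 3)) c = m}"
    using minimal_height_base[OF g] colour_count_board_of[OF _ m] board_of_chessboard
    by (simp add: minimal_height_def)
qed

lemma card_excited_chessboards:
  assumes n: "n = 2 * p + 1" and m: "2 * int m = (\<Sum>i\<le>n. row_min n (int p) i)"
  shows "card {c \<in> chessboards n. colour_count n (nat (int p mod 3)) c = Suc m} = card (flip_sites n (int p))"
proof -
  let ?g = "int p"
  let ?f = "\<lambda>s. board_of n (excited_height n ?g s)"
  have g: "2 * ?g + 1 \<le> int n" "int n \<le> 2 * ?g + 2" using n by simp_all
  have "{c \<in> chessboards n. colour_count n (nat (?g mod 3)) c = Suc m} = ?f ` flip_sites n ?g"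
  proof (intro equalityI subsetI)
    fix c assume "c \<in> {c \<in> chessboards n. colour_count n (nat (?g mod 3)) c = Suc m}"
    then have c: "c \<in> chessboards n" "colour_count n (nat (?g mod 3)) c = Suc m" by auto
    obtain H where H: "height_fun n H"
      "\<And>i j. i \<le> n \<Longrightarrow> j \<le> n \<Longrightarrow> int (c (Suc i, Suc j)) = H i j mod 3"
      "colour_count n (nat (?g mod 3)) c = m + card (bad_steps n ?g H)"
      using chessboard_bad_steps[OF c(1) m] by blast
    then have "card (bad_steps n ?g H) = 1" using c by simp
    then obtain s where s: "s \<in> flip_sites n ?g"
      "\<And>i j. i \<le> n \<Longrightarrow> j \<le> n \<Longrightarrow> H i j = excited_height n ?g s i j"
      using excess_one_is_excited[OF n H(1)] by blast
    have "c = ?f s" using H(2) s(2) by (intro chessboard_eq_board_of[OF c(1)]) simp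
    then show "c \<in> ?f ` flip_sites n ?g" using s by blast
  next
    fix c assume "c \<in> ?f ` flip_sites n ?g"
    then show "c \<in> {c \<in> chessboards n. colour_count n (nat (?g mod 3)) c = Suc m}"
      using excited_height[OF g] colour_count_board_of[OF _ m] board_of_chessboard by auto
  qed
  moreover have "inj_on ?f (flip_sites n ?g)"
  \<comment> \<open>The flip at \<open>s\<close> changes the colour there, since 2 is not divisible
    by 3, whereas a flip at another site leaves the colour at \<open>s\<close> alone.\<close>
  proof (rule inj_onI, rule ccontr)
    fix s s' assume s: "s \<in> flip_sites n ?g" "s' \<in> flip_sites n ?g" "?f s = ?f s'" "s \<noteq> s'"
    obtain i j where ij: "s = (i, j)" by (cases s)
    have le: "i \<le> n" "j \<le> n" and nc: "\<not> in_class ?g (base_height n ?g i j)"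
      using s(1) by (auto simp: ij flip_sites_def)
    have "nat (excited_height n ?g s i j mod 3) = nat (excited_height n ?g s' i j mod 3)"
      using fun_cong[OF s(3), of "(Suc i, Suc j)"] le by (simp add: board_of_Suc)
    moreover have "excited_height n ?g s' i j = base_height n ?g i j"
      using s(4) ij by (auto simp: excited_height_def flip_height_def split: prod.splits)
    moreover have "excited_height n ?g s i j = base_height n ?g i j + 2 \<or>
        excited_height n ?g s i j = base_height n ?g i j - 2"
      by (auto simp: ij excited_height_def flip_height_def)
    moreover have "nat ((h + 2) mod 3) \<noteq> nat (h mod 3)" "nat ((h - 2) mod 3) \<noteq> nat (h mod 3)" for h :: int
    proof -
      have "(h + 2) mod 3 \<noteq> h mod 3" "(h - 2) mod 3 \<noteq> h mod 3" by presburger+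
      then show "nat ((h + 2) mod 3) \<noteq> nat (h mod 3)" "nat ((h - 2) mod 3) \<noteq> nat (h mod 3)"
        by (metis nat_0_le pos_mod_sign zero_less_numeral)+
    qed
    ultimately show False by metis
  qed
  ultimately show ?thesis by (simp add: card_image)
qed

text \<open>The base height has no bad steps, so its number of class squares is the required half of
  the sum; no parity computation is needed.\<close>

lemma row_min_sum_nat:
  assumes g: "2 * g + 1 \<le> int n" "int n \<le> 2 * g + 2"
  obtains m where "2 * int m = (\<Sum>i\<le>n. row_min n g i)"
proof -
  have "2 * int (card (class_squares n g (base_height n g))) = (\<Sum>i\<le>n. row_min n g i)"
    using card_class_squares[of n "base_height n g" g] minimal_height_base[OF g] by (simp add: minimal_height_def)
  then show thesis by (rule that)
qed

section \<open>Lowest-order terms of the partition function\<close>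

lemma Z3C_odd:
  assumes n: "n = 2 * p + 1"
  obtains P m where "3 * m = 2 * (p + 1) * (p + 2) + (if p mod 3 = 0 then 2 else 0)"
    "\<And>x. Z3C n (\<lambda>i. if i = p mod 3 then x else 1) = x ^ m * poly P x"
    "coeff P 0 = 1" "coeff P 1 + (if p = 0 then 0 else 2) = of_nat (2 * p * (p + 1))"
proof -
  have g: "2 * int p + 1 \<le> int n" "int n \<le> 2 * int p + 2" using n by simp_all
  obtain m where m: "2 * int m = (\<Sum>i\<le>n. row_min n (int p) i)" by (rule row_min_sum_nat[OF g])
  have k: "nat (int p mod 3) = p mod 3" by (simp add: nat_mod_as_int)
  have "m \<le> colour_count n (p mod 3) c" if "c \<in> chessboards n" for c
    using chessboard_bad_steps[OF that m] k by (metis le_add1)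
  then obtain P where P: "\<And>x. Z3C n (\<lambda>i. if i = p mod 3 then x else 1) = x ^ m * poly P x"
    "coeff P 0 = of_nat (card {c \<in> chessboards n. colour_count n (p mod 3) c = m})"
    "coeff P 1 = of_nat (card {c \<in> chessboards n. colour_count n (p mod 3) c = Suc m})"
    using Z3C_one_colour_poly by blast
  have "3 * (2 * int m) = int (2 * (2 * (p + 1) * (p + 2) + (if p mod 3 = 0 then 2 else 0)))"
    unfolding m sum_row_min_odd[OF n] by simp
  then have "3 * (2 * m) = 2 * (2 * (p + 1) * (p + 2) + (if p mod 3 = 0 then 2 else 0))" by linarith
  then have "3 * m = 2 * (p + 1) * (p + 2) + (if p mod 3 = 0 then 2 else 0)" by simp
  moreover have "coeff P 0 = 1" using P(2) minimal_chessboard[OF g m] k by simp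
  moreover have "coeff P 1 + (if p = 0 then 0 else 2) = of_nat (2 * p * (p + 1))"
    unfolding P(3) card_excited_chessboards[OF n m, unfolded k] card_flip_sites_odd[OF n, symmetric]
    by simp
  ultimately show thesis using that P(1) by blast
qed

text \<open>The largest height below \<open>n / 2\<close> is now \<open>p - 1\<close>, with colour
  \<open>(p + 2) mod 3\<close>. For \<open>p = 0\<close> it is the class of -1, which the integer
  classes admit without a separate case.\<close>

lemma Z3C_even:
  assumes n: "n = 2 * p"
  obtains P m where "3 * m = 2 * p * (p + 2) + (if p mod 3 = 2 then 2 else 0)"
    "\<And>x. Z3C n (\<lambda>i. if i = (p + 2) mod 3 then x else 1) = x ^ m * poly P x" "coeff P 0 = 1"
proof -
  let ?g = "int p - 1"
  have g: "2 * ?g + 1 \<le> int n" "int n \<le> 2 * ?g + 2" using n by simp_all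
  obtain m where m: "2 * int m = (\<Sum>i\<le>n. row_min n ?g i)" by (rule row_min_sum_nat[OF g])
  have "?g mod 3 = int ((p + 2) mod 3)" by (simp add: zmod_int) presburger
  then have k: "nat (?g mod 3) = (p + 2) mod 3" by simp
  have "m \<le> colour_count n ((p + 2) mod 3) c" if "c \<in> chessboards n" for c
    using chessboard_bad_steps[OF that m] k by (metis le_add1)
  then obtain P where P: "\<And>x. Z3C n (\<lambda>i. if i = (p + 2) mod 3 then x else 1) = x ^ m * poly P x"
    "coeff P 0 = of_nat (card {c \<in> chessboards n. colour_count n ((p + 2) mod 3) c = m})"
    using Z3C_one_colour_poly by blast
  have "3 * (2 * int m) = int (2 * (2 * p * (p + 2) + (if p mod 3 = 2 then 2 else 0)))"
    unfolding m sum_row_min_even[OF n] by simp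
  then have "3 * (2 * m) = 2 * (2 * p * (p + 2) + (if p mod 3 = 2 then 2 else 0))" by linarith
  then have "3 * m = 2 * p * (p + 2) + (if p mod 3 = 2 then 2 else 0)" by simp
  moreover have "coeff P 0 = 1" using P(2) minimal_chessboard[OF g m] k by simp
  ultimately show thesis using that P(1) by blast
qed

text \<open>The middle row forces at least one bad step, so one more power of \<open>x\<close>
  divides the partition function than the row minima predict; this is included in
  \<open>m\<close>.\<close>

lemma Z3C_even_middle:
  assumes n: "n = 2 * p" "0 < p"
  obtains P m where "3 * m = 2 * p * (p + 2) + (if p mod 3 = 2 then 2 else 6)"
    "\<And>x. Z3C n (\<lambda>i. if i = p mod 3 then x else 1) = x ^ m * poly P x"
proof -
  have g: "2 * (int p - 1) + 1 \<le> int n" "int n \<le> 2 * (int p - 1) + 2" using n by simp_all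
  have H: "height_fun n (base_height n (int p - 1))" by (rule height_fun_base[OF g])
  have sum: "3 * (\<Sum>i\<le>n. row_min n (int p) i) = 4 * int (p * (p + 2)) + (if p mod 3 = 2 then -2 else 6)"
    by (rule sum_row_min_middle[OF n(1)])
  moreover have "1 \<le> int (p * (p + 2))" using n(2) by (cases p) auto
  moreover have "- 2 \<le> (if p mod 3 = 2 then - 2 else 6 :: int)" by simp
  ultimately have pos: "0 \<le> (\<Sum>i\<le>n. row_min n (int p) i)" by linarith
  obtain m where m: "2 * int m = (\<Sum>i\<le>n. row_min n (int p) i)"
  proof
    \<comment> \<open>Any height function shows that the sum is even; the base height of the class
      of \<open>p - 1\<close> is at hand, although it does have bad steps for the class of
      \<open>p\<close>.\<close>
    show "2 * int (nat (int (card (class_squares n (int p) (base_height n (int p - 1))))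
        - int (card (bad_steps n (int p) (base_height n (int p - 1)))))) = (\<Sum>i\<le>n. row_min n (int p) i)"
      using card_class_squares[OF H, of "int p"] pos by simp
  qed
  have k: "nat (int p mod 3) = p mod 3" by (simp add: nat_mod_as_int)
  have "Suc m \<le> colour_count n (p mod 3) c" if c: "c \<in> chessboards n" for c
  proof -
    obtain H where H: "height_fun n H" "colour_count n (p mod 3) c = m + card (bad_steps n (int p) H)"
      using chessboard_bad_steps[OF c m] k by metis
    have "0 < card (bad_steps n (int p) H)"
      using middle_class_bad_step[OF n H(1)] by (simp add: card_gt_0_iff)
    then show ?thesis using H(2) by simp
  qed
  then obtain P where P: "\<And>x. Z3C n (\<lambda>i. if i = p mod 3 then x else 1) = x ^ Suc m * poly P x"
    using Z3C_one_colour_poly by blast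
  have "int (2 * (3 * Suc m)) = 3 * (2 * int m) + 6" by simp
  also have "\<dots> = int (2 * (2 * p * (p + 2) + (if p mod 3 = 2 then 2 else 6)))"
    unfolding m sum by simp
  finally have "2 * (3 * Suc m) = 2 * (2 * p * (p + 2) + (if p mod 3 = 2 then 2 else 6))"
    by (simp only: of_nat_eq_iff)
  then have "3 * Suc m = 2 * p * (p + 2) + (if p mod 3 = 2 then 2 else 6)" by simp
  then show thesis using that P by blast
qed

subsection \<open>Leading coefficients\<close>

text \<open>\<open>x ^ (2 * D) * f T\<close> as a polynomial in \<open>x\<close>, where \<open>T = (1 + 2 * x) ^ 3 / x ^ 2\<close> is the value of
  \<open>TT\<close> when one variable is \<open>x\<close> and the others are 1.\<close>

definition lift_poly :: "nat \<Rightarrow> complex poly \<Rightarrow> complex poly" where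
  "lift_poly D f = (\<Sum>j\<le>D. smult (coeff f j) (monom 1 (2 * (D - j)) * [:1, 2:] ^ (3 * j)))"

lemma poly_lift_poly:
  assumes "\<forall>k>D. coeff f k = 0" "x \<noteq> 0"
  shows "poly (lift_poly D f) x = x ^ (2 * D) * poly f ((1 + 2 * x) ^ 3 / x ^ 2)"
proof -
  have "degree f \<le> D" using assms(1) by (simp add: degree_le)
  then have "poly f y = (\<Sum>j\<le>D. coeff f j * y ^ j)" for y
    unfolding poly_altdef by (intro sum.mono_neutral_left) (auto simp: coeff_eq_0)
  moreover have "x ^ (2 * (D - j)) * (1 + 2 * x) ^ (3 * j)
      = x ^ (2 * D) * ((1 + 2 * x) ^ 3 / x ^ 2) ^ j" if "j \<le> D" for j
  proof -
    have "x ^ (2 * D) = x ^ (2 * (D - j)) * (x ^ 2) ^ j"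
      using that by (simp flip: power_add power_mult add: algebra_simps)
    then show ?thesis using assms(2) by (simp add: power_divide power_mult)
  qed
  ultimately show ?thesis
    by (auto simp: lift_poly_def poly_sum poly_monom sum_distrib_left algebra_simps
        intro!: sum.cong)
qed

lemma coeff_affine_power: "coeff ([:1, 2:] ^ k :: complex poly) 0 = 1"
  "coeff ([:1, 2:] ^ k :: complex poly) (Suc 0) = 2 * of_nat k"
  by (induction k) (auto simp: algebra_simps)

text \<open>The summands with \<open>j < D\<close> are divisible by \<open>x ^ 2\<close>, so only
  \<open>(1 + 2 * x) ^ (3 * D)\<close> matters in the first two orders. This is the origin of the
  constant 6.\<close>

lemma coeff_lift_poly:
  "coeff (lift_poly D f) 0 = coeff f D"
  "coeff (lift_poly D f) (Suc 0) = 6 * of_nat D * coeff f D"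
proof -
  have "coeff (lift_poly D f) 0 = (\<Sum>j\<le>D. if j = D then coeff f D else 0)"
    unfolding lift_poly_def coeff_sum
    by (intro sum.cong) (auto simp: coeff_monom_mult coeff_affine_power)
  then show "coeff (lift_poly D f) 0 = coeff f D" by simp
  have "coeff (lift_poly D f) (Suc 0) = (\<Sum>j\<le>D. if j = D then 6 * of_nat D * coeff f D else 0)"
    unfolding lift_poly_def coeff_sum
    by (intro sum.cong) (auto simp: coeff_monom_mult coeff_affine_power)
  then show "coeff (lift_poly D f) (Suc 0) = 6 * of_nat D * coeff f D" by simp
qed

lemma poly_eqI_nonzero:
  fixes p q :: "complex poly"
  assumes "\<And>x. x \<noteq> 0 \<Longrightarrow> poly p x = poly q x"
  shows "p = q"
proof -
  have "poly ([:0, 1:] * p) x = poly ([:0, 1:] * q) x" for x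
    using assms[of x] by (cases "x = 0") auto
  then have "[:0, 1:] * p = [:0, 1:] * q" by (intro poly_ext)
  then show ?thesis by simp
qed

text \<open>Multiplication by \<open>x ^ (2 * (D - D0))\<close> clears all denominators once
  \<open>D\<close> bounds the degree of \<open>f\<close> and \<open>D - d\<close> that of
  \<open>g\<close>.\<close>

lemma lift_identity:
  fixes P u v f g :: "complex poly"
  assumes id: "\<And>x. x \<noteq> 0 \<Longrightarrow> poly P x = x ^ (2 * D0) *
      (poly u x * poly f ((1 + 2 * x) ^ 3 / x ^ 2)
        + poly v x * poly g ((1 + 2 * x) ^ 3 / x ^ 2) / x ^ (2 * d))"
    and f: "\<forall>k>D. coeff f k = 0" and g: "\<forall>k. D < k + d \<longrightarrow> coeff g k = 0" and "D0 \<le> D"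
  shows "monom 1 (2 * (D - D0)) * P = u * lift_poly D f + v * lift_poly (D - d) g"
proof (rule poly_eqI_nonzero)
  fix x :: complex assume x: "x \<noteq> 0"
  let ?T = "(1 + 2 * x) ^ 3 / x ^ 2"
  have D: "x ^ (2 * D) = x ^ (2 * (D - D0)) * x ^ (2 * D0)"
    using \<open>D0 \<le> D\<close> by (simp flip: power_add add: algebra_simps)
  have g': "poly (lift_poly (D - d) g) x = x ^ (2 * D) * poly g ?T / x ^ (2 * d)"
  proof (cases "d \<le> D")
    case True
    then have "x ^ (2 * D) = x ^ (2 * (D - d)) * x ^ (2 * d)"
      by (simp flip: power_add add: algebra_simps)
    moreover have "\<forall>k>D - d. coeff g k = 0" using g True by auto
    ultimately show ?thesis using poly_lift_poly[of "D - d" g x] x by simp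
  next
    case False
    \<comment> \<open>Here \<open>D - d\<close> is a truncated difference, and the degree condition
      leaves only the zero polynomial.\<close>
    then have "g = 0" using g by (intro poly_eqI) auto
    then show ?thesis by (simp add: lift_poly_def)
  qed
  show "poly (monom 1 (2 * (D - D0)) * P) x
      = poly (u * lift_poly D f + v * lift_poly (D - d) g) x"
    unfolding poly_mult poly_add g' poly_lift_poly[OF f x] id[OF x] D poly_monom
    by (simp add: algebra_simps)
qed

text \<open>The factor \<open>x\<close> before \<open>v\<close> separates the tops of
  \<open>f\<close> and \<open>g\<close> by one order. As long as a bound \<open>D\<close> exceeds
  \<open>D0\<close>, the left side of the cleared identity is divisible by \<open>x ^ 2\<close>:
  order 0 removes the coefficient of \<open>f\<close> at \<open>D\<close>, and then order 1 that of
  \<open>g\<close> at \<open>D - d\<close>. At \<open>D0\<close> the same two orders are compared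
  with those of \<open>P\<close>.\<close>

lemma leading_terms:
  fixes P u v f g :: "complex poly"
  assumes id: "\<And>x. x \<noteq> 0 \<Longrightarrow> poly P x = x ^ (2 * D0) *
      (poly u x * poly f ((1 + 2 * x) ^ 3 / x ^ 2)
        - x * poly v x * poly g ((1 + 2 * x) ^ 3 / x ^ 2) / x ^ (2 * d))"
    and u: "coeff u 0 \<noteq> 0" and v: "coeff v 0 \<noteq> 0"
  shows "\<forall>k>D0. coeff f k = 0" "\<forall>k. D0 < k + d \<longrightarrow> coeff g k = 0"
    "coeff P 0 = coeff u 0 * coeff f D0"
    "coeff P 1 = (coeff u 1 + 6 * of_nat D0 * coeff u 0) * coeff f D0
       - coeff v 0 * coeff g (D0 - d)"
proof -
  let ?B = "\<lambda>D. (\<forall>k>D. coeff f k = 0) \<and> (\<forall>k. D < k + d \<longrightarrow> coeff g k = 0)"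
  have id': "poly P x = x ^ (2 * D0) *
      (poly u x * poly f ((1 + 2 * x) ^ 3 / x ^ 2)
        + poly (pCons 0 (- v)) x * poly g ((1 + 2 * x) ^ 3 / x ^ 2) / x ^ (2 * d))"
    if "x \<noteq> 0" for x
    using id[OF that] by simp
  have eq: "monom 1 (2 * (D - D0)) * P = u * lift_poly D f + pCons 0 (- v) * lift_poly (D - d) g"
    if "?B D" "D0 \<le> D" for D
    using lift_identity[OF id'] that by blast
  have c: "coeff (monom 1 (2 * (D - D0)) * P) 0 = coeff u 0 * coeff f D"
    "coeff (monom 1 (2 * (D - D0)) * P) 1 = (coeff u 1 + 6 * of_nat D * coeff u 0) * coeff f D
       - coeff v 0 * coeff g (D - d)"
    if "?B D" "D0 \<le> D" for D
    unfolding eq[OF that]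
    by (simp_all add: coeff_mult coeff_lift_poly algebra_simps)
  have down: "?B (D - 1)" if B: "?B D" and D: "D0 < D" for D
  proof -
    have f: "coeff f D = 0" using c(1)[of D] B D u by (simp add: coeff_monom_mult)
    have "Suc 0 < 2 * (D - D0)" using D by simp
    then have g: "coeff g (D - d) = 0" using c(2)[of D] B D f v by (simp add: coeff_monom_mult)
    show ?thesis
    proof (intro conjI allI impI)
      fix k assume "D - 1 < k"
      then show "coeff f k = 0" using f B by (cases "k = D") auto
    next
      fix k assume "D - 1 < k + d"
      then show "coeff g k = 0" using g B by (cases "k + d = D") auto
    qed
  qed
  have "?B (D0 + j) \<Longrightarrow> ?B D0" for j
  proof (induction j)
    case (Suc j)
    then show ?case using down[of "D0 + Suc j"] by simp
  qed simp
  \<comment> \<open>A trivial bound from which the descent starts.\<close>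
  moreover have "?B (D0 + (degree f + degree g + d))"
    by (auto intro!: coeff_eq_0)
  ultimately have B: "?B D0" by blast
  then show "\<forall>k>D0. coeff f k = 0" "\<forall>k. D0 < k + d \<longrightarrow> coeff g k = 0" by auto
  show "coeff P 0 = coeff u 0 * coeff f D0"
    "coeff P 1 = (coeff u 1 + 6 * of_nat D0 * coeff u 0) * coeff f D0
       - coeff v 0 * coeff g (D0 - d)"
    using c[of D0] B by (simp_all add: coeff_monom_mult)
qed

text \<open>Here both tops occur in order 0, while the left side vanishes there, so they must
  cancel.\<close>

lemma leading_cancellation:
  fixes P u v f g :: "complex poly"
  assumes id: "\<And>x. x \<noteq> 0 \<Longrightarrow> x * poly P x = x ^ (2 * D0) *
      (poly u x * poly f ((1 + 2 * x) ^ 3 / x ^ 2)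
        - poly v x * poly g ((1 + 2 * x) ^ 3 / x ^ 2) / x ^ (2 * d))"
    and "\<forall>k>D0. coeff f k = 0" "\<forall>k. D0 < k + d \<longrightarrow> coeff g k = 0"
  shows "coeff u 0 * coeff f D0 = coeff v 0 * coeff g (D0 - d)"
proof -
  have "monom 1 (2 * (D0 - D0)) * pCons 0 P = u * lift_poly D0 f + (- v) * lift_poly (D0 - d) g"
    by (rule lift_identity) (use assms in \<open>auto\<close>)
  from arg_cong[OF this, of "\<lambda>p. coeff p 0"] show ?thesis
    by (simp add: coeff_mult coeff_lift_poly)
qed

section \<open>Specialisation of the defining identity\<close>

lemma one_colour_values:
  assumes "k < 3"
  shows "e2 (\<lambda>i. if i = k then x else 1) = 1 + 2 * x" "e3 (\<lambda>i. if i = k then x else 1) = x"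
    "TT (\<lambda>i. if i = k then x else 1) = (1 + 2 * x) ^ 3 / x ^ 2"
proof -
  have "k = 0 \<or> k = 1 \<or> k = 2" using assms by auto
  then show "e2 (\<lambda>i. if i = k then x else 1) = 1 + 2 * x" "e3 (\<lambda>i. if i = k then x else 1) = x"
    by (auto simp: e2_def e3_def)
  then show "TT (\<lambda>i. if i = k then x else 1) = (1 + 2 * x) ^ 3 / x ^ 2" by (simp add: TT_def)
qed

lemma monic_of_coeffs:
  assumes "\<forall>k>D. coeff f k = 0" "coeff f D = 1"
  shows "lead_coeff f = 1" "deg f = int D"
proof -
  have "degree f = D" using assms by (intro antisym degree_le le_degree) auto
  moreover from this have "f \<noteq> 0" using assms by auto
  ultimately show "lead_coeff f = 1" "deg f = int D" using assms by (auto simp: deg_def)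
qed

lemma is_qrD:
  assumes "is_qr n q r" "k < 3" "x \<noteq> 0"
  shows "n mod 3 = 0 \<Longrightarrow> Z3C n (\<lambda>i. if i = k then x else 1) = (-1) ^ (n+1) * x ^ (n * (n+2) div 3) *
      ((1 + 2 * x) ^ 2 / x * poly q ((1 + 2 * x) ^ 3 / x ^ 2)
       - 2 ^ of_bool (odd n) * (if k = 0 then x else 1) * poly r ((1 + 2 * x) ^ 3 / x ^ 2))"
    "n mod 3 = 1 \<Longrightarrow> Z3C n (\<lambda>i. if i = k then x else 1) = (-1) ^ (n+1) * x ^ (n * (n+2) div 3) *
      ((if k = 2 then 1 / x else x) * poly q ((1 + 2 * x) ^ 3 / x ^ 2)
       - 2 ^ of_bool (odd n) * ((1 + 2 * x) / (if k = 2 then x else 1)) * poly r ((1 + 2 * x) ^ 3 / x ^ 2))"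
    "n mod 3 = 2 \<Longrightarrow> Z3C n (\<lambda>i. if i = k then x else 1) = (-1) ^ (n+1) * x ^ ((n+1) ^ 2 div 3) *
      (poly q ((1 + 2 * x) ^ 3 / x ^ 2)
       - 2 ^ of_bool (odd n) * ((1 + 2 * x) / (if k = 1 then 1 else x)) * poly r ((1 + 2 * x) ^ 3 / x ^ 2))"
proof -
  have k: "k = 0 \<or> k = 1 \<or> k = 2" using assms(2) by auto
  let ?t = "\<lambda>i. if i = k then x else 1"
  have "?t 0 \<noteq> 0 \<and> ?t 1 \<noteq> 0 \<and> ?t 2 \<noteq> 0" using assms(3) by simp
  note qr = assms(1)[unfolded is_qr_def, rule_format, OF this, unfolded one_colour_values[OF assms(2)]]
  show "n mod 3 = 0 \<Longrightarrow> Z3C n ?t = (-1) ^ (n+1) * x ^ (n * (n+2) div 3) *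
      ((1 + 2 * x) ^ 2 / x * poly q ((1 + 2 * x) ^ 3 / x ^ 2)
       - 2 ^ of_bool (odd n) * (if k = 0 then x else 1) * poly r ((1 + 2 * x) ^ 3 / x ^ 2))"
    using qr k by auto
  show "n mod 3 = 1 \<Longrightarrow> Z3C n ?t = (-1) ^ (n+1) * x ^ (n * (n+2) div 3) *
      ((if k = 2 then 1 / x else x) * poly q ((1 + 2 * x) ^ 3 / x ^ 2)
       - 2 ^ of_bool (odd n) * ((1 + 2 * x) / (if k = 2 then x else 1)) * poly r ((1 + 2 * x) ^ 3 / x ^ 2))"
    using qr k by auto
  show "n mod 3 = 2 \<Longrightarrow> Z3C n ?t = (-1) ^ (n+1) * x ^ ((n+1) ^ 2 div 3) *
      (poly q ((1 + 2 * x) ^ 3 / x ^ 2)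
       - 2 ^ of_bool (odd n) * ((1 + 2 * x) / (if k = 1 then 1 else x)) * poly r ((1 + 2 * x) ^ 3 / x ^ 2))"
    using qr k by auto
qed

section \<open>Degrees and leading coefficients from the expansions\<close>

text \<open>Order 1 reads \<open>6 * D - 2 = 6 * D - 2 * c\<close> with \<open>c\<close> the
  coefficient of \<open>r\<close> at \<open>D - 1\<close>. For \<open>D = 0\<close> there is no such
  coefficient and \<open>r = 0\<close>.\<close>

lemma qr_degrees_1_or_5:
  assumes id: "\<And>x. x \<noteq> 0 \<Longrightarrow> poly P x = x ^ (2 * D) *
      (poly q ((1 + 2 * x) ^ 3 / x ^ 2) - 2 * (1 + 2 * x) / x * poly r ((1 + 2 * x) ^ 3 / x ^ 2))"
    and P: "coeff P 0 = 1" "coeff P 1 + (if D = 0 then 0 else 2) = of_nat (6 * D)"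
  shows "lead_coeff q = 1" "deg q = int D" "r \<noteq> 0 \<longrightarrow> lead_coeff r = 1" "deg q = deg r + 1"
proof -
  have "poly P x = x ^ (2 * D) * (poly 1 x * poly q ((1 + 2 * x) ^ 3 / x ^ 2)
      - x * poly [:2, 4:] x * poly r ((1 + 2 * x) ^ 3 / x ^ 2) / x ^ (2 * 1))" if "x \<noteq> 0" for x
    unfolding id[OF that] using that by (simp add: field_simps power2_eq_square)
  note lt = leading_terms[OF this, simplified]
  have q: "coeff q D = 1" using lt(3) P by simp
  show "lead_coeff q = 1" and dq: "deg q = int D" using monic_of_coeffs[OF lt(1) q] by auto
  have "(r \<noteq> 0 \<longrightarrow> lead_coeff r = 1) \<and> deg q = deg r + 1"
  proof (cases "D = 0")
    case True
    then have "r = 0" using lt(2) by (intro poly_eqI) auto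
    then show ?thesis using True dq by (auto simp: deg_def)
  next
    case False
    then have "coeff r (D - 1) = 1" using lt(4) P(2) q by simp
    moreover have "\<forall>k>D - 1. coeff r k = 0" using lt(2) by auto
    ultimately show ?thesis using monic_of_coeffs[of "D - 1" r] False dq by auto
  qed
  then show "r \<noteq> 0 \<longrightarrow> lead_coeff r = 1" "deg q = deg r + 1" by auto
qed

text \<open>The factor \<open>(1 + 2 * x) ^ 2\<close> adds 4 in order 1, so
  \<open>6 * D + 2 = 6 * D + 4 - 2 * c\<close> with \<open>c\<close> the coefficient of
  \<open>r\<close> at \<open>D\<close>.\<close>

lemma qr_degrees_3:
  assumes id: "\<And>x. x \<noteq> 0 \<Longrightarrow> poly P x = x ^ (2 * D) *
      ((1 + 2 * x) ^ 2 * poly q ((1 + 2 * x) ^ 3 / x ^ 2) - 2 * x * poly r ((1 + 2 * x) ^ 3 / x ^ 2))"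
    and P: "coeff P 0 = 1" "coeff P 1 = of_nat (6 * D + 2)"
  shows "lead_coeff q = 1" "deg q = int D" "lead_coeff r = 1" "deg r = int D"
proof -
  have "poly P x = x ^ (2 * D) * (poly ([:1, 2:] ^ 2) x * poly q ((1 + 2 * x) ^ 3 / x ^ 2)
      - x * poly [:2:] x * poly r ((1 + 2 * x) ^ 3 / x ^ 2) / x ^ (2 * 0))" if "x \<noteq> 0" for x
    unfolding id[OF that] by (simp add: algebra_simps)
  note lt = leading_terms[OF this, unfolded coeff_affine_power One_nat_def, simplified]
  have q: "coeff q D = 1" using lt(3) P by simp
  have r: "coeff r D = 1" using lt(4) P(2) q by simp
  show "lead_coeff q = 1" "deg q = int D" using monic_of_coeffs[OF lt(1) q] by auto
  show "lead_coeff r = 1" "deg r = int D" using monic_of_coeffs[OF lt(2) r] by auto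
qed

text \<open>The first identity determines \<open>r\<close> and bounds the degree of
  \<open>q\<close>; the second, from the middle colour, transfers the leading coefficient to
  \<open>q\<close>. It is guarded by \<open>0 < D\<close>: for \<open>n = 0\<close> the only square
  has the middle colour and \<open>q = 0\<close>.\<close>

lemma qr_degrees_0:
  assumes id: "\<And>x. x \<noteq> 0 \<Longrightarrow> poly P x = x ^ (2 * D) *
      (poly r ((1 + 2 * x) ^ 3 / x ^ 2) - (1 + 2 * x) ^ 2 / x * poly q ((1 + 2 * x) ^ 3 / x ^ 2))"
    and P: "coeff P 0 = 1"
    and id': "\<And>x. 0 < D \<Longrightarrow> x \<noteq> 0 \<Longrightarrow> x * poly P' x = x ^ (2 * D) *
      (poly r ((1 + 2 * x) ^ 3 / x ^ 2) - (1 + 2 * x) ^ 2 / x ^ 2 * poly q ((1 + 2 * x) ^ 3 / x ^ 2))"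
  shows "lead_coeff r = 1" "deg r = int D" "q \<noteq> 0 \<longrightarrow> lead_coeff q = 1" "deg q + 1 = deg r"
proof -
  have "poly P x = x ^ (2 * D) * (poly 1 x * poly r ((1 + 2 * x) ^ 3 / x ^ 2)
      - x * poly ([:1, 2:] ^ 2) x * poly q ((1 + 2 * x) ^ 3 / x ^ 2) / x ^ (2 * 1))" if "x \<noteq> 0" for x
    unfolding id[OF that] using that by (simp add: field_simps power2_eq_square)
  note lt = leading_terms[OF this, unfolded coeff_affine_power One_nat_def, simplified]
  have r: "coeff r D = 1" using lt(3) P by simp
  show "lead_coeff r = 1" and dr: "deg r = int D" using monic_of_coeffs[OF lt(1) r] by auto
  have "(q \<noteq> 0 \<longrightarrow> lead_coeff q = 1) \<and> deg q + 1 = deg r"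
  proof (cases "D = 0")
    case True
    then have "q = 0" using lt(2) by (intro poly_eqI) auto
    then show ?thesis using True dr by (auto simp: deg_def)
  next
    case False
    then have "x * poly P' x = x ^ (2 * D) * (poly 1 x * poly r ((1 + 2 * x) ^ 3 / x ^ 2)
        - poly ([:1, 2:] ^ 2) x * poly q ((1 + 2 * x) ^ 3 / x ^ 2) / x ^ (2 * 1))" if "x \<noteq> 0" for x
      using id'[of x] that by (simp add: algebra_simps power2_eq_square)
    note lc = leading_cancellation[OF this lt(1)]
    have "coeff q (D - 1) = 1" using lc lt(2) r by (simp add: coeff_affine_power)
    moreover have "\<forall>k>D - 1. coeff q k = 0" using lt(2) by auto
    ultimately show ?thesis using monic_of_coeffs[of "D - 1" q] False dr by auto
  qed
  then show "q \<noteq> 0 \<longrightarrow> lead_coeff q = 1" "deg q + 1 = deg r" by auto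
qed

lemma qr_degrees_2_or_4:
  assumes id: "\<And>x. x \<noteq> 0 \<Longrightarrow> poly P x = x ^ (2 * D) *
      ((1 + 2 * x) * poly r ((1 + 2 * x) ^ 3 / x ^ 2) - x * poly q ((1 + 2 * x) ^ 3 / x ^ 2))"
    and P: "coeff P 0 = 1"
    and id': "\<And>x. x \<noteq> 0 \<Longrightarrow> x * poly P' x = x ^ (2 * D) *
      ((1 + 2 * x) * poly r ((1 + 2 * x) ^ 3 / x ^ 2) - poly q ((1 + 2 * x) ^ 3 / x ^ 2))"
  shows "lead_coeff r = 1" "deg r = int D" "lead_coeff q = 1" "deg q = int D"
proof -
  have "poly P x = x ^ (2 * D) * (poly [:1, 2:] x * poly r ((1 + 2 * x) ^ 3 / x ^ 2)
      - x * poly 1 x * poly q ((1 + 2 * x) ^ 3 / x ^ 2) / x ^ (2 * 0))" if "x \<noteq> 0" for x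
    unfolding id[OF that] by (simp add: algebra_simps)
  note lt = leading_terms[OF this, simplified]
  have "x * poly P' x = x ^ (2 * D) * (poly [:1, 2:] x * poly r ((1 + 2 * x) ^ 3 / x ^ 2)
      - poly 1 x * poly q ((1 + 2 * x) ^ 3 / x ^ 2) / x ^ (2 * 0))" if "x \<noteq> 0" for x
    unfolding id'[OF that] by (simp add: algebra_simps)
  note lc = leading_cancellation[OF this lt(1)]
  have r: "coeff r D = 1" using lt(3) P by simp
  have q: "coeff q D = 1" using lc lt(2) r by simp
  show "lead_coeff r = 1" "deg r = int D" using monic_of_coeffs[OF lt(1) r] by auto
  show "lead_coeff q = 1" "deg q = int D" using monic_of_coeffs[OF lt(2) q] by auto
qed

section \<open>The six residues modulo 6\<close>

text \<open>As in all six cases, \<open>D\<close> is half the gap between the exponent of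
  \<open>e3\<close> in the defining identity and the minimal exponent \<open>m\<close>, corrected by
  the powers of \<open>x\<close> in the prefactors; here \<open>e2 ^ 2 / e3\<close> contributes
  \<open>1 / x\<close>.\<close>

lemma qr_degrees_mod_6_eq_3:
  assumes qr: "is_qr n q r" and n: "n = 6 * a + 3"
  shows "lead_coeff q = 1" "deg q = 3 * int a ^ 2 + 3 * int a" "lead_coeff r = 1" "deg r = 3 * int a ^ 2 + 3 * int a"
proof -
  define D where "D = 3 * a ^ 2 + 3 * a"
  have D: "int D = 3 * int a ^ 2 + 3 * int a" by (simp add: D_def)
  have np: "n = 2 * (3 * a + 1) + 1" using n by simp
  obtain P m where m: "3 * m = 2 * (3 * a + 1 + 1) * (3 * a + 1 + 2) + (if (3 * a + 1) mod 3 = 0 then 2 else 0)"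
    and Z: "\<And>x. Z3C n (\<lambda>i. if i = (3 * a + 1) mod 3 then x else 1) = x ^ m * poly P x"
    and P: "coeff P 0 = 1" "coeff P 1 + (if 3 * a + 1 = 0 then 0 else 2) = of_nat (2 * (3 * a + 1) * (3 * a + 1 + 1))"
    using Z3C_odd[OF np] by blast
  have k: "(3 * a + 1) mod 3 = 1" by presburger
  have "3 * m = 3 * (6 * a ^ 2 + 10 * a + 4)" using m unfolding k by (simp add: power2_eq_square algebra_simps)
  then have m: "m = 6 * a ^ 2 + 10 * a + 4" by simp
  have "n * (n + 2) = 3 * (m + 2 * D + 1)" by (simp add: n m D_def power2_eq_square algebra_simps)
  then have e: "n * (n + 2) div 3 = m + 2 * D + 1" by simp
  have n3: "n mod 3 = 0" "odd n" using n by presburger+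
  have id: "poly P x = x ^ (2 * D) *
      ((1 + 2 * x) ^ 2 * poly q ((1 + 2 * x) ^ 3 / x ^ 2) - 2 * x * poly r ((1 + 2 * x) ^ 3 / x ^ 2))"
    if x: "x \<noteq> 0" for x
  proof -
    have "x ^ m * poly P x = x ^ (m + 2 * D + 1) *
      ((1 + 2 * x) ^ 2 / x * poly q ((1 + 2 * x) ^ 3 / x ^ 2) - 2 * poly r ((1 + 2 * x) ^ 3 / x ^ 2))"
      using is_qrD(1)[OF qr, of 1 x] Z[of x, unfolded k] n3 x e by simp
    also have "\<dots> = x ^ m * (x ^ (2 * D) *
      ((1 + 2 * x) ^ 2 * poly q ((1 + 2 * x) ^ 3 / x ^ 2) - 2 * x * poly r ((1 + 2 * x) ^ 3 / x ^ 2)))"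
      using x by (simp add: power_add field_simps)
    finally show ?thesis using x by simp
  qed
  have "of_nat (6 * D + 2) + 2 = (of_nat (2 * (3 * a + 1) * (3 * a + 1 + 1)) :: complex)"
    by (simp add: D_def power2_eq_square algebra_simps)
  then have "coeff P 1 = of_nat (6 * D + 2)" using P(2) by simp
  from qr_degrees_3[OF id P(1) this] D
  show "lead_coeff q = 1" "deg q = 3 * int a ^ 2 + 3 * int a" "lead_coeff r = 1" "deg r = 3 * int a ^ 2 + 3 * int a"
    by simp_all
qed

lemma qr_degrees_mod_6_eq_1:
  assumes qr: "is_qr n q r" and n: "n = 6 * a + 1"
  shows "lead_coeff q = 1" "deg q = 3 * int a ^ 2 + int a" "r \<noteq> 0 \<longrightarrow> lead_coeff r = 1" "deg q = deg r + 1"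
proof -
  define D where "D = 3 * a ^ 2 + a"
  have D: "int D = 3 * int a ^ 2 + int a" by (simp add: D_def)
  have np: "n = 2 * (3 * a) + 1" using n by simp
  obtain P m where m: "3 * m = 2 * (3 * a + 1) * (3 * a + 2) + (if (3 * a) mod 3 = 0 then 2 else 0)"
    and Z: "\<And>x. Z3C n (\<lambda>i. if i = (3 * a) mod 3 then x else 1) = x ^ m * poly P x"
    and P: "coeff P 0 = 1" "coeff P 1 + (if 3 * a = 0 then 0 else 2) = of_nat (2 * (3 * a) * (3 * a + 1))"
    using Z3C_odd[OF np] by blast
  have k: "(3 * a) mod 3 = 0" by presburger
  have "3 * m = 3 * (6 * a ^ 2 + 6 * a + 2)" using m unfolding k by (simp add: power2_eq_square algebra_simps)
  \<comment> \<open>The exponent in the identity is \<open>m - 1 + 2 * D\<close>, the missing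
    \<open>x\<close> being the value of \<open>t 0 * t 1 / t 2\<close>; naming \<open>m - 1\<close>
    avoids a truncated difference.\<close>
  moreover define l where "l = 6 * a ^ 2 + 6 * a + 1"
  ultimately have m: "m = l + 1" by simp
  have "n * (n + 2) = 3 * (l + 2 * D)" by (simp add: n l_def D_def power2_eq_square algebra_simps)
  then have e: "n * (n + 2) div 3 = l + 2 * D" by simp
  have n3: "n mod 3 = 1" "odd n" using n by presburger+
  have id: "poly P x = x ^ (2 * D) *
      (poly q ((1 + 2 * x) ^ 3 / x ^ 2) - 2 * (1 + 2 * x) / x * poly r ((1 + 2 * x) ^ 3 / x ^ 2))"
    if x: "x \<noteq> 0" for x
  proof -
    have "x ^ m * poly P x = x ^ (l + 2 * D) *
      (x * poly q ((1 + 2 * x) ^ 3 / x ^ 2) - 2 * (1 + 2 * x) * poly r ((1 + 2 * x) ^ 3 / x ^ 2))"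
      using is_qrD(2)[OF qr, of 0 x] Z[of x, unfolded k] n3 x e by simp
    also have "\<dots> = x ^ m * (x ^ (2 * D) *
      (poly q ((1 + 2 * x) ^ 3 / x ^ 2) - 2 * (1 + 2 * x) / x * poly r ((1 + 2 * x) ^ 3 / x ^ 2)))"
      using x by (simp add: m power_add field_simps)
    finally show ?thesis using x by simp
  qed
  have "6 * D = 2 * (3 * a) * (3 * a + 1)" "D = 0 \<longleftrightarrow> 3 * a = 0"
    by (simp_all add: D_def power2_eq_square algebra_simps)
  then have "coeff P 1 + (if D = 0 then 0 else 2) = of_nat (6 * D)" using P(2) by simp
  from qr_degrees_1_or_5[OF id P(1) this] D
  show "lead_coeff q = 1" "deg q = 3 * int a ^ 2 + int a" "r \<noteq> 0 \<longrightarrow> lead_coeff r = 1" "deg q = deg r + 1"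
    by simp_all
qed

lemma qr_degrees_mod_6_eq_5:
  assumes qr: "is_qr n q r" and n: "n = 6 * a + 5"
  shows "lead_coeff q = 1" "deg q = 3 * int a ^ 2 + 5 * int a + 2" "r \<noteq> 0 \<longrightarrow> lead_coeff r = 1" "deg q = deg r + 1"
proof -
  define D where "D = 3 * a ^ 2 + 5 * a + 2"
  have D: "int D = 3 * int a ^ 2 + 5 * int a + 2" by (simp add: D_def)
  have np: "n = 2 * (3 * a + 2) + 1" using n by simp
  obtain P m where m: "3 * m = 2 * (3 * a + 2 + 1) * (3 * a + 2 + 2) + (if (3 * a + 2) mod 3 = 0 then 2 else 0)"
    and Z: "\<And>x. Z3C n (\<lambda>i. if i = (3 * a + 2) mod 3 then x else 1) = x ^ m * poly P x"
    and P: "coeff P 0 = 1" "coeff P 1 + (if 3 * a + 2 = 0 then 0 else 2) = of_nat (2 * (3 * a + 2) * (3 * a + 2 + 1))"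
    using Z3C_odd[OF np] by blast
  have k: "(3 * a + 2) mod 3 = 2" by presburger
  have "3 * m = 3 * (6 * a ^ 2 + 14 * a + 8)" using m unfolding k by (simp add: power2_eq_square algebra_simps)
  then have m: "m = 6 * a ^ 2 + 14 * a + 8" by simp
  have "(n + 1) ^ 2 = 3 * (m + 2 * D)" by (simp add: n m D_def power2_eq_square algebra_simps)
  then have e: "(n + 1) ^ 2 div 3 = m + 2 * D" by simp
  have n3: "n mod 3 = 2" "odd n" using n by presburger+
  have id: "poly P x = x ^ (2 * D) *
      (poly q ((1 + 2 * x) ^ 3 / x ^ 2) - 2 * (1 + 2 * x) / x * poly r ((1 + 2 * x) ^ 3 / x ^ 2))"
    if x: "x \<noteq> 0" for x
  proof -
    have "x ^ m * poly P x = x ^ m * (x ^ (2 * D) *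
      (poly q ((1 + 2 * x) ^ 3 / x ^ 2) - 2 * (1 + 2 * x) / x * poly r ((1 + 2 * x) ^ 3 / x ^ 2)))"
      using is_qrD(3)[OF qr, of 2 x] Z[of x, unfolded k] n3 x
      unfolding e power_add by (simp add: field_simps)
    then show ?thesis using x by simp
  qed
  have "6 * D = 2 * (3 * a + 2) * (3 * a + 2 + 1)" "D \<noteq> 0"
    by (simp_all add: D_def power2_eq_square algebra_simps)
  then have "coeff P 1 + (if D = 0 then 0 else 2) = of_nat (6 * D)" using P(2) by simp
  from qr_degrees_1_or_5[OF id P(1) this] D
  show "lead_coeff q = 1" "deg q = 3 * int a ^ 2 + 5 * int a + 2" "r \<noteq> 0 \<longrightarrow> lead_coeff r = 1" "deg q = deg r + 1"
    by simp_all
qed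

lemma qr_degrees_mod_6_eq_0:
  assumes qr: "is_qr n q r" and n: "n = 6 * a"
  shows "lead_coeff r = 1" "deg r = 3 * int a ^ 2" "q \<noteq> 0 \<longrightarrow> lead_coeff q = 1" "deg q + 1 = deg r"
proof -
  define D where "D = 3 * a ^ 2"
  have D: "int D = 3 * int a ^ 2" by (simp add: D_def)
  have np: "n = 2 * (3 * a)" using n by simp
  have k: "(3 * a) mod 3 = 0" "(3 * a + 2) mod 3 = 2" by presburger+
  have n3: "n mod 3 = 0" "even n" using n by presburger+
  obtain P m where m: "3 * m = 2 * (3 * a) * (3 * a + 2) + (if (3 * a) mod 3 = 2 then 2 else 0)"
    and Z: "\<And>x. Z3C n (\<lambda>i. if i = (3 * a + 2) mod 3 then x else 1) = x ^ m * poly P x"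
    and P: "coeff P 0 = 1"
    using Z3C_even[OF np] by blast
  have "3 * m = 3 * (6 * a ^ 2 + 4 * a)" using m unfolding k by (simp add: power2_eq_square algebra_simps)
  then have m: "m = 6 * a ^ 2 + 4 * a" by simp
  have "n * (n + 2) = 3 * (m + 2 * D)" by (simp add: n m D_def power2_eq_square algebra_simps)
  then have e: "n * (n + 2) div 3 = m + 2 * D" by simp
  have id: "poly P x = x ^ (2 * D) *
      (poly r ((1 + 2 * x) ^ 3 / x ^ 2) - (1 + 2 * x) ^ 2 / x * poly q ((1 + 2 * x) ^ 3 / x ^ 2))"
    if x: "x \<noteq> 0" for x
  proof -
    have "x ^ m * poly P x = x ^ m * (x ^ (2 * D) *
      (poly r ((1 + 2 * x) ^ 3 / x ^ 2) - (1 + 2 * x) ^ 2 / x * poly q ((1 + 2 * x) ^ 3 / x ^ 2)))"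
      using is_qrD(1)[OF qr, of 2 x] Z[of x, unfolded k] n3 x
      unfolding e power_add by (simp add: field_simps)
    then show ?thesis using x by simp
  qed
  have "\<exists>P'. \<forall>x. 0 < D \<longrightarrow> x \<noteq> 0 \<longrightarrow> x * poly P' x = x ^ (2 * D) *
      (poly r ((1 + 2 * x) ^ 3 / x ^ 2) - (1 + 2 * x) ^ 2 / x ^ 2 * poly q ((1 + 2 * x) ^ 3 / x ^ 2))"
  proof (cases "0 < D")
    case True
    then have "0 < 3 * a" by (simp add: D_def)
    then obtain P' m' where m': "3 * m' = 2 * (3 * a) * (3 * a + 2) + (if (3 * a) mod 3 = 2 then 2 else 6)"
      and Z': "\<And>x. Z3C n (\<lambda>i. if i = (3 * a) mod 3 then x else 1) = x ^ m' * poly P' x"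
      using Z3C_even_middle[OF np] by blast
    \<comment> \<open>One of the two extra factors \<open>x\<close> cancels against
      \<open>t 0 = x\<close>; the other is the factor in \<open>x * poly P' x\<close> needed for the
      cancellation of the tops.\<close>
    have "3 * m' = 3 * (m + 2)" using m' unfolding k by (simp add: m power2_eq_square algebra_simps)
    then have "m' = m + 2" by simp
    then have m': "x ^ m' = x ^ m * x * x" for x :: complex by (simp add: power2_eq_square)
    have "x * poly P' x = x ^ (2 * D) *
      (poly r ((1 + 2 * x) ^ 3 / x ^ 2) - (1 + 2 * x) ^ 2 / x ^ 2 * poly q ((1 + 2 * x) ^ 3 / x ^ 2))"
      if x: "x \<noteq> 0" for x
    proof -
      have "(x ^ m * x) * (x * poly P' x) = - (x ^ (m + 2 * D) *
        ((1 + 2 * x) ^ 2 / x * poly q ((1 + 2 * x) ^ 3 / x ^ 2) - x * poly r ((1 + 2 * x) ^ 3 / x ^ 2)))"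
        using is_qrD(1)[OF qr, of 0 x] Z'[of x, unfolded k m'] n3 x e by (simp add: mult.assoc)
      also have "\<dots> = (x ^ m * x) * (x ^ (2 * D) *
        (poly r ((1 + 2 * x) ^ 3 / x ^ 2) - (1 + 2 * x) ^ 2 / x ^ 2 * poly q ((1 + 2 * x) ^ 3 / x ^ 2)))"
        using x by (simp add: power_add field_simps power2_eq_square)
      finally show ?thesis using x by simp
    qed
    then show ?thesis by blast
  qed simp
  then obtain P' where id': "\<And>x. 0 < D \<Longrightarrow> x \<noteq> 0 \<Longrightarrow> x * poly P' x = x ^ (2 * D) *
      (poly r ((1 + 2 * x) ^ 3 / x ^ 2) - (1 + 2 * x) ^ 2 / x ^ 2 * poly q ((1 + 2 * x) ^ 3 / x ^ 2))"
    by blast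
  from qr_degrees_0[OF id P id'] D
  show "lead_coeff r = 1" "deg r = 3 * int a ^ 2" "q \<noteq> 0 \<longrightarrow> lead_coeff q = 1" "deg q + 1 = deg r"
    by simp_all
qed

lemma qr_degrees_mod_6_eq_2:
  assumes qr: "is_qr n q r" and n: "n = 6 * a + 2"
  shows "lead_coeff r = 1" "deg r = 3 * int a ^ 2 + 2 * int a" "lead_coeff q = 1" "deg q = 3 * int a ^ 2 + 2 * int a"
proof -
  define D where "D = 3 * a ^ 2 + 2 * a"
  have D: "int D = 3 * int a ^ 2 + 2 * int a" by (simp add: D_def)
  have np: "n = 2 * (3 * a + 1)" "0 < 3 * a + 1" using n by simp_all
  have k: "(3 * a + 1) mod 3 = 1" "(3 * a + 1 + 2) mod 3 = 0" by presburger+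
  have n3: "n mod 3 = 2" "even n" using n by presburger+
  obtain P m where m: "3 * m = 2 * (3 * a + 1) * (3 * a + 1 + 2) + (if (3 * a + 1) mod 3 = 2 then 2 else 0)"
    and Z: "\<And>x. Z3C n (\<lambda>i. if i = (3 * a + 1 + 2) mod 3 then x else 1) = x ^ m * poly P x"
    and P: "coeff P 0 = 1"
    using Z3C_even[OF np(1)] by blast
  obtain P' m' where m': "3 * m' = 2 * (3 * a + 1) * (3 * a + 1 + 2) + (if (3 * a + 1) mod 3 = 2 then 2 else 6)"
    and Z': "\<And>x. Z3C n (\<lambda>i. if i = (3 * a + 1) mod 3 then x else 1) = x ^ m' * poly P' x"
    using Z3C_even_middle[OF np] by blast
  have "3 * m = 3 * (6 * a ^ 2 + 8 * a + 2)" using m unfolding k by (simp add: power2_eq_square algebra_simps)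
  then have m: "m = 6 * a ^ 2 + 8 * a + 2" by simp
  have "3 * m' = 3 * (m + 2)" using m' unfolding k by (simp add: m power2_eq_square algebra_simps)
  then have "m' = m + 2" by simp
  then have m': "x ^ m' = x ^ m * x * x" for x :: complex by (simp add: power2_eq_square)
  have "(n + 1) ^ 2 = 3 * (m + 2 * D + 1)" by (simp add: n m D_def power2_eq_square algebra_simps)
  then have e: "(n + 1) ^ 2 div 3 = m + 2 * D + 1" by simp
  have id: "poly P x = x ^ (2 * D) *
      ((1 + 2 * x) * poly r ((1 + 2 * x) ^ 3 / x ^ 2) - x * poly q ((1 + 2 * x) ^ 3 / x ^ 2))"
    if x: "x \<noteq> 0" for x
  proof -
    have "x ^ m * poly P x = - (x ^ (m + 2 * D + 1) *
      (poly q ((1 + 2 * x) ^ 3 / x ^ 2) - (1 + 2 * x) / x * poly r ((1 + 2 * x) ^ 3 / x ^ 2)))"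
      using is_qrD(3)[OF qr, of 0 x] Z[of x, unfolded k] n3 x e by simp
    also have "\<dots> = x ^ m * (x ^ (2 * D) *
      ((1 + 2 * x) * poly r ((1 + 2 * x) ^ 3 / x ^ 2) - x * poly q ((1 + 2 * x) ^ 3 / x ^ 2)))"
      using x by (simp add: power_add field_simps)
    finally show ?thesis using x by simp
  qed
  have id': "x * poly P' x = x ^ (2 * D) *
      ((1 + 2 * x) * poly r ((1 + 2 * x) ^ 3 / x ^ 2) - poly q ((1 + 2 * x) ^ 3 / x ^ 2))"
    if x: "x \<noteq> 0" for x
  proof -
    have "(x ^ m * x) * (x * poly P' x) = (x ^ m * x) * (x ^ (2 * D) *
      ((1 + 2 * x) * poly r ((1 + 2 * x) ^ 3 / x ^ 2) - poly q ((1 + 2 * x) ^ 3 / x ^ 2)))"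
      using is_qrD(3)[OF qr, of 1 x] Z'[of x, unfolded k m'] n3 x
      unfolding e power_add by (simp add: field_simps)
    then show ?thesis using x by simp
  qed
  from qr_degrees_2_or_4[OF id P id'] D
  show "lead_coeff r = 1" "deg r = 3 * int a ^ 2 + 2 * int a" "lead_coeff q = 1" "deg q = 3 * int a ^ 2 + 2 * int a"
    by simp_all
qed

lemma qr_degrees_mod_6_eq_4:
  assumes qr: "is_qr n q r" and n: "n = 6 * a + 4"
  shows "lead_coeff r = 1" "deg r = 3 * int a ^ 2 + 4 * int a + 1" "lead_coeff q = 1" "deg q = 3 * int a ^ 2 + 4 * int a + 1"
proof -
  define D where "D = 3 * a ^ 2 + 4 * a + 1"
  have D: "int D = 3 * int a ^ 2 + 4 * int a + 1" by (simp add: D_def)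
  have np: "n = 2 * (3 * a + 2)" "0 < 3 * a + 2" using n by simp_all
  have k: "(3 * a + 2) mod 3 = 2" "(3 * a + 2 + 2) mod 3 = 1" by presburger+
  have n3: "n mod 3 = 1" "even n" using n by presburger+
  obtain P m where m: "3 * m = 2 * (3 * a + 2) * (3 * a + 2 + 2) + (if (3 * a + 2) mod 3 = 2 then 2 else 0)"
    and Z: "\<And>x. Z3C n (\<lambda>i. if i = (3 * a + 2 + 2) mod 3 then x else 1) = x ^ m * poly P x"
    and P: "coeff P 0 = 1"
    using Z3C_even[OF np(1)] by blast
  obtain P' m' where m': "3 * m' = 2 * (3 * a + 2) * (3 * a + 2 + 2) + (if (3 * a + 2) mod 3 = 2 then 2 else 6)"
    and Z': "\<And>x. Z3C n (\<lambda>i. if i = (3 * a + 2) mod 3 then x else 1) = x ^ m' * poly P' x"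
    using Z3C_even_middle[OF np] by blast
  \<comment> \<open>Both colours have the same exponent; the \<open>x\<close> in
    \<open>x * poly P' x\<close> comes from the common denominator \<open>t 2 = x\<close> of both
    terms.\<close>
  have m'm: "m' = m" using m m' unfolding k by simp
  have "3 * m = 3 * (6 * a ^ 2 + 12 * a + 6)" using m unfolding k by (simp add: power2_eq_square algebra_simps)
  then have m: "m = 6 * a ^ 2 + 12 * a + 6" by simp
  have "n * (n + 2) = 3 * (m + 2 * D)" by (simp add: n m D_def power2_eq_square algebra_simps)
  then have e: "n * (n + 2) div 3 = m + 2 * D" by simp
  have id: "poly P x = x ^ (2 * D) *
      ((1 + 2 * x) * poly r ((1 + 2 * x) ^ 3 / x ^ 2) - x * poly q ((1 + 2 * x) ^ 3 / x ^ 2))"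
    if x: "x \<noteq> 0" for x
  proof -
    have "x ^ m * poly P x = x ^ m * (x ^ (2 * D) *
      ((1 + 2 * x) * poly r ((1 + 2 * x) ^ 3 / x ^ 2) - x * poly q ((1 + 2 * x) ^ 3 / x ^ 2)))"
      using is_qrD(2)[OF qr, of 1 x] Z[of x, unfolded k] n3 x
      unfolding e power_add by (simp add: field_simps)
    then show ?thesis using x by simp
  qed
  have id': "x * poly P' x = x ^ (2 * D) *
      ((1 + 2 * x) * poly r ((1 + 2 * x) ^ 3 / x ^ 2) - poly q ((1 + 2 * x) ^ 3 / x ^ 2))"
    if x: "x \<noteq> 0" for x
  proof -
    have "x ^ m * (x * poly P' x) = x ^ m * (x ^ (2 * D) *
      ((1 + 2 * x) * poly r ((1 + 2 * x) ^ 3 / x ^ 2) - poly q ((1 + 2 * x) ^ 3 / x ^ 2)))"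
      using is_qrD(2)[OF qr, of 2 x] Z'[of x, unfolded k m'm] n3 x
      unfolding e power_add by (simp add: field_simps)
    then show ?thesis using x by simp
  qed
  from qr_degrees_2_or_4[OF id P id'] D
  show "lead_coeff r = 1" "deg r = 3 * int a ^ 2 + 4 * int a + 1" "lead_coeff q = 1" "deg q = 3 * int a ^ 2 + 4 * int a + 1"
    by simp_all
qed

theorem theorem3p2:
  fixes n :: nat and q r :: "complex poly"
  assumes "is_qr n q r"
  shows "(q \<noteq> 0 \<longrightarrow> lead_coeff q = 1) \<and> (r \<noteq> 0 \<longrightarrow> lead_coeff r = 1) \<and>
    (n mod 6 = 0 \<longrightarrow>
       deg q + 1 = deg r \<and> real_of_int (deg r) = (real n ^ 2) / 12) \<and>
    (n mod 6 = 1 \<or> n mod 6 = 5 \<longrightarrow>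
       deg q = deg r + 1 \<and> real_of_int (deg q) = (real n ^ 2 - 1) / 12) \<and>
    (n mod 6 = 2 \<or> n mod 6 = 4 \<longrightarrow>
       deg q = deg r \<and> real_of_int (deg r) = (real n ^ 2 - 4) / 12) \<and>
    (n mod 6 = 3 \<longrightarrow>
       deg q = deg r \<and> real_of_int (deg r) = (real n ^ 2 - 9) / 12)"
proof -
  define a where "a = n div 6"
  have n: "n = 6 * a + n mod 6" by (simp add: a_def)
  have "n mod 6 < 6" by simp
  then consider "n mod 6 = 0" | "n mod 6 = 1" | "n mod 6 = 2" | "n mod 6 = 3" | "n mod 6 = 4" | "n mod 6 = 5"
    by linarith
  then show ?thesis
  proof cases
    case 1
    then have na: "n = 6 * a" using n by simp
    then have "real n ^ 2 / 12 = real_of_int (3 * int a ^ 2)" by (simp add: power2_eq_square)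
    with 1 show ?thesis using qr_degrees_mod_6_eq_0[OF assms na] by simp
  next
    case 2
    then have na: "n = 6 * a + 1" using n by simp
    then have "(real n ^ 2 - 1) / 12 = real_of_int (3 * int a ^ 2 + int a)"
      by (simp add: power2_eq_square field_simps)
    with 2 show ?thesis using qr_degrees_mod_6_eq_1[OF assms na] by simp
  next
    case 3
    then have na: "n = 6 * a + 2" using n by simp
    then have "(real n ^ 2 - 4) / 12 = real_of_int (3 * int a ^ 2 + 2 * int a)"
      by (simp add: power2_eq_square field_simps)
    with 3 show ?thesis using qr_degrees_mod_6_eq_2[OF assms na] by simp
  next
    case 4
    then have na: "n = 6 * a + 3" using n by simp
    then have "(real n ^ 2 - 9) / 12 = real_of_int (3 * int a ^ 2 + 3 * int a)"
      by (simp add: power2_eq_square field_simps)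
    with 4 show ?thesis using qr_degrees_mod_6_eq_3[OF assms na] by simp
  next
    case 5
    then have na: "n = 6 * a + 4" using n by simp
    then have "(real n ^ 2 - 4) / 12 = real_of_int (3 * int a ^ 2 + 4 * int a + 1)"
      by (simp add: power2_eq_square field_simps)
    with 5 show ?thesis using qr_degrees_mod_6_eq_4[OF assms na] by simp
  next
    case 6
    then have na: "n = 6 * a + 5" using n by simp
    then have "(real n ^ 2 - 1) / 12 = real_of_int (3 * int a ^ 2 + 5 * int a + 2)"
      by (simp add: power2_eq_square field_simps)
    with 6 show ?thesis using qr_degrees_mod_6_eq_5[OF assms na] by simp
  qed
qed

end
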